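(* Let $K\subseteq L^0$ be a wedge and let $\Phi:[0,\infty)\to(-\infty,\infty]$ be a convex function which may take the value $\infty$ only at $0$. If $\Phi$ satisfies the growth condition and $M_\Phi\neq\emptyset$, then $$F_\Phi\cap\mathcal W(R(M_1))=\mathcal W(R(\widehat M_\Phi))=\overline{\mathcal W(R(M_\Phi))}^{\sigma(F_\Phi,E_\Phi)}.$$ Moreover, $$C_\Phi=c_{E_\Phi}(K)=\overline{K_\Phi}^{\sigma(E_\Phi,F_\Phi)}$$ and $$R(\widehat M_\Phi)=\overline{R(M_\Phi)}^{\sigma(F_\Phi,E_\Phi)}.$$
   Context: $(\Omega,\mathcal F,\mathbb P)$ is a probability space and $L^0=L^0(\Omega,\mathcal F,\mathbb P)$ is the vector lattice of real random variables modulo $\mathbb P$-a.s. equality, ordered $\mathbb P$-a.s. For a probability measure $\mathbb Q\ll\mathbb P$, $L^1(\mathbb Q)$ is regarded as the set of $X\in L^0$ with $\mathbb E_{\mathbb Q}|X|<\infty$, and $L^1_+(\mathbb Q)$ is its subset of non-negative elements. A wedge in a real vector space is a non-empty convex set $C$ with $\lambda C\subseteq C$ for all $\lambda\ge0$. $\mathcal W(S)$ is the smallest wedge containing the non-empty set $S$; $[S]$ is the linear span of $S$. $M_1=M_1(\mathbb P;K)$ is the set of all probability measures $\mathbb Q\ll\mathbb P$ such that $K\subseteq L^1(\mathbb Q)$ and $\mathbb E_{\mathbb Q}[X]\le0$ for all $X\in K$. $R(\mathbb Q):=\frac{d\mathbb Q}{d\mathbb P}\in L^1(\mathbb P)$.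 With $\Phi^+=\max\{\Phi,0\}$: $M_\Phi=\{\mathbb Q\in M_1:\mathbb E_{\mathbb P}[\Phi^+(\frac{d\mathbb Q}{d\mathbb P})]<\infty\}$ and $\widehat M_\Phi=\{\mathbb Q\in M_1:\mathbb E_{\mathbb P}[\Phi^+(\frac{d\mathbb Q}{d\mathbb P})1_{\{d\mathbb Q/d\mathbb P\ge1\}}]<\infty\}$. Growth condition on $\Phi$: for every interval $[\lambda_0,\lambda_1]\subseteq(0,\infty)$ there exist $\alpha>0$, $\beta>0$ such that $\Phi^+(\lambda y)\le\alpha\Phi^+(y)+\beta(y+1)$ for all $y>0$ and all $\lambda\in[\lambda_0,\lambda_1]$. $E_\Phi:=\bigcap_{\mathbb Q\in M_\Phi}L^1(\mathbb Q)$ and $F_\Phi:=[R(M_\Phi)]\subseteq L^1(\mathbb P)$, with bilinear form $\langle z,w\rangle:=\mathbb E_{\mathbb P}[zw]$ on $E_\Phi\times F_\Phi$ and associated weak topologies $\sigma(E_\Phi,F_\Phi)$ and $\sigma(F_\Phi,E_\Phi)$ (not necessarily Hausdorff). $K_\Phi:=s_{E_\Phi}(K):=K-(E_\Phi)_+=\{x\in E_\Phi:x\le g\text{ for some }g\in K\}$, and $c_{E_\Phi}(K):=\overline{s_{E_\Phi}(K)}^{\sigma(E_\Phi,F_\Phi)}$. $C_\Phi:=\bigcap_{\mathbb Q\in M_\Phi}\overline{K-L^1_+(\mathbb Q)}^{L^1(\mathbb Q)}\subseteq E_\Phi$, where the closure consists of all $X\in L^1(\mathbb Q)$ for which there are $X_n\in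 K-L^1_+(\mathbb Q)$ with $\mathbb E_{\mathbb Q}|X-X_n|\to0$. *)

theory Defs
  imports "HOL-Probability.Probability"
begin

section \<open>The space of random variables modulo almost sure equality\<close>

text \<open>
  An element of the space is an equivalence class of real Borel functions modulo equality almost
  everywhere. As the space depends on the measure, it is a carrier set rather than a type, and its
  operations are computed on representatives; the lemmas below show that the choice of the
  representative is immaterial.
\<close>

type_synonym 'a rv_class = "('a \<Rightarrow> real) set"

definition ae_rel :: "'a measure \<Rightarrow> (('a \<Rightarrow> real) \<times> ('a \<Rightarrow> real)) set" where
  "ae_rel P = {(f, g). f \<in> borel_measurable P \<and> g \<in> borel_measurable P \<and>
                       (AE \<omega> in P. f \<omega> = g \<omega>)}"

definition L0 :: "'a measure \<Rightarrow> 'a rv_class set" where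
  "L0 P = borel_measurable P // ae_rel P"

definition ae_class :: "'a measure \<Rightarrow> ('a \<Rightarrow> real) \<Rightarrow> 'a rv_class" where
  "ae_class P f = ae_rel P `` {f}"

definition rep :: "'a rv_class \<Rightarrow> 'a \<Rightarrow> real" where
  "rep X = (SOME f. f \<in> X)"

definition L0_zero :: "'a measure \<Rightarrow> 'a rv_class" where
  "L0_zero P = ae_class P (\<lambda>\<omega>. 0)"

definition L0_add :: "'a measure \<Rightarrow> 'a rv_class \<Rightarrow> 'a rv_class \<Rightarrow> 'a rv_class" where
  "L0_add P X Y = ae_class P (\<lambda>\<omega>. rep X \<omega> + rep Y \<omega>)"

definition L0_diff :: "'a measure \<Rightarrow> 'a rv_class \<Rightarrow> 'a rv_class \<Rightarrow> 'a rv_class" where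
  "L0_diff P X Y = ae_class P (\<lambda>\<omega>. rep X \<omega> - rep Y \<omega>)"

definition L0_scale :: "'a measure \<Rightarrow> real \<Rightarrow> 'a rv_class \<Rightarrow> 'a rv_class" where
  "L0_scale P c X = ae_class P (\<lambda>\<omega>. c * rep X \<omega>)"

definition L0_le :: "'a measure \<Rightarrow> 'a rv_class \<Rightarrow> 'a rv_class \<Rightarrow> bool" where
  "L0_le P X Y \<longleftrightarrow> (AE \<omega> in P. rep X \<omega> \<le> rep Y \<omega>)"

definition nonneg_part :: "'a measure \<Rightarrow> 'a rv_class set \<Rightarrow> 'a rv_class set" where
  "nonneg_part P A = {X \<in> A. L0_le P (L0_zero P) X}"

lemma equiv_ae_rel: "equiv (borel_measurable P) (ae_rel P)"
  proof (rule equivI)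
  show "ae_rel P \<subseteq> borel_measurable P \<times> borel_measurable P"
    by (auto simp: ae_rel_def)
  show "refl_on (borel_measurable P) (ae_rel P)"
    by (rule refl_onI) (simp add: ae_rel_def)
  show "sym (ae_rel P)"
    by (rule symI) (simp add: ae_rel_def eq_commute)
  show "trans (ae_rel P)"
  proof (rule transI)
    fix f g h assume fg: "(f, g) \<in> ae_rel P" and gh: "(g, h) \<in> ae_rel P"
    then have "AE \<omega> in P. f \<omega> = g \<omega>" "AE \<omega> in P. g \<omega> = h \<omega>"
      by (simp_all add: ae_rel_def)
    then have "AE \<omega> in P. f \<omega> = h \<omega>"
      by eventually_elim simp
    with fg gh show "(f, h) \<in> ae_rel P"
      by (simp add: ae_rel_def)
  qed
qed

lemma ae_class_in_L0: "f \<in> borel_measurable P \<Longrightarrow> ae_class P f \<in> L0 P"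
  by (auto simp: L0_def ae_class_def intro: quotientI)

lemma rep_in:
  assumes "X \<in> L0 P"
  shows "rep X \<in> X"
proof -
  have "X \<noteq> {}"
    using in_quotient_imp_non_empty[OF equiv_ae_rel] assms by (simp add: L0_def)
  then show ?thesis
    by (simp add: rep_def some_in_eq)
qed

lemma rep_measurable: "X \<in> L0 P \<Longrightarrow> rep X \<in> borel_measurable P"
  using rep_in[of X P] in_quotient_imp_subset[OF equiv_ae_rel, of X P] by (auto simp: L0_def)

lemma ae_class_rep:
  assumes "X \<in> L0 P"
  shows "ae_class P (rep X) = X"
proof -
  obtain f where X: "X = ae_rel P `` {f}"
    using assms unfolding L0_def by (rule quotientE)
  then have "(f, rep X) \<in> ae_rel P"
    using rep_in[OF assms] by blast
  then have "ae_rel P `` {f} = ae_rel P `` {rep X}"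
    by (rule equiv_class_eq[OF equiv_ae_rel])
  then show ?thesis
    unfolding ae_class_def using X by (rule trans[OF sym sym])
qed

lemma rep_ae_class:
  assumes "f \<in> borel_measurable P"
  shows "AE \<omega> in P. rep (ae_class P f) \<omega> = f \<omega>"
  using rep_in[OF ae_class_in_L0[OF assms]]
  by (auto simp: ae_class_def ae_rel_def elim: eventually_mono)


section \<open>Wedges and linear spans\<close>

definition wedge :: "'a measure \<Rightarrow> 'a rv_class set \<Rightarrow> bool" where
  "wedge P C \<longleftrightarrow> C \<subseteq> L0 P \<and> C \<noteq> {} \<and>
     (\<forall>X\<in>C. \<forall>Y\<in>C. \<forall>t\<in>{0..1}. L0_add P (L0_scale P (1 - t) X) (L0_scale P t Y) \<in> C) \<and>
     (\<forall>X\<in>C. \<forall>c\<ge>0. L0_scale P c X \<in> C)"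

definition wedge_hull :: "'a measure \<Rightarrow> 'a rv_class set \<Rightarrow> 'a rv_class set" where
  "wedge_hull P S = \<Inter>{C. wedge P C \<and> S \<subseteq> C}"

definition lin_subspace :: "'a measure \<Rightarrow> 'a rv_class set \<Rightarrow> bool" where
  "lin_subspace P V \<longleftrightarrow> V \<subseteq> L0 P \<and> L0_zero P \<in> V \<and>
     (\<forall>X\<in>V. \<forall>Y\<in>V. L0_add P X Y \<in> V) \<and> (\<forall>X\<in>V. \<forall>c. L0_scale P c X \<in> V)"

definition lin_span :: "'a measure \<Rightarrow> 'a rv_class set \<Rightarrow> 'a rv_class set" where
  "lin_span P S = \<Inter>{V. lin_subspace P V \<and> S \<subseteq> V}"


section \<open>Integrable classes and the sets of measures\<close>

definition L1 :: "'a measure \<Rightarrow> 'a measure \<Rightarrow> 'a rv_class set" where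
  "L1 P Q = {X \<in> L0 P. integrable Q (rep X)}"

definition expect :: "'a measure \<Rightarrow> 'a rv_class \<Rightarrow> real" where
  "expect Q X = (LINT \<omega>|Q. rep X \<omega>)"

definition M1 :: "'a measure \<Rightarrow> 'a rv_class set \<Rightarrow> 'a measure set" where
  "M1 P K = {Q. prob_space Q \<and> sets Q = sets P \<and> absolutely_continuous P Q \<and>
                K \<subseteq> L1 P Q \<and> (\<forall>X\<in>K. expect Q X \<le> 0)}"

definition dens :: "'a measure \<Rightarrow> 'a measure \<Rightarrow> 'a \<Rightarrow> real" where
  "dens P Q \<omega> = enn2real (RN_deriv P Q \<omega>)"

definition R :: "'a measure \<Rightarrow> 'a measure \<Rightarrow> 'a rv_class" where
  "R P Q = ae_class P (dens P Q)"

definition pos_phi :: "(real \<Rightarrow> ereal) \<Rightarrow> real \<Rightarrow> ereal" where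
  "pos_phi \<Phi> y = max (\<Phi> y) 0"

definition M_Phi :: "'a measure \<Rightarrow> 'a rv_class set \<Rightarrow> (real \<Rightarrow> ereal) \<Rightarrow> 'a measure set" where
  "M_Phi P K \<Phi> = {Q \<in> M1 P K. (\<integral>\<^sup>+ \<omega>. e2ennreal (pos_phi \<Phi> (dens P Q \<omega>)) \<partial>P) < \<infinity>}"

definition M_hat_Phi :: "'a measure \<Rightarrow> 'a rv_class set \<Rightarrow> (real \<Rightarrow> ereal) \<Rightarrow> 'a measure set" where
  "M_hat_Phi P K \<Phi> = {Q \<in> M1 P K.
     (\<integral>\<^sup>+ \<omega>. e2ennreal (pos_phi \<Phi> (dens P Q \<omega>)) * indicator {\<omega>. dens P Q \<omega> \<ge> 1} \<omega> \<partial>P) < \<infinity>}"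


section \<open>Convexity and growth condition\<close>

text \<open>
  \<open>\<Phi>\<close> is a function on the half-line; its values at negative arguments are irrelevant.
\<close>

definition convex_on_halfline :: "(real \<Rightarrow> ereal) \<Rightarrow> bool" where
  "convex_on_halfline \<Phi> \<longleftrightarrow> (\<forall>x\<ge>0. \<forall>y\<ge>0. \<forall>t. 0 < t \<and> t < 1 \<longrightarrow>
     \<Phi> ((1 - t) * x + t * y) \<le> ereal (1 - t) * \<Phi> x + ereal t * \<Phi> y)"

definition growth_condition :: "(real \<Rightarrow> ereal) \<Rightarrow> bool" where
  "growth_condition \<Phi> \<longleftrightarrow> (\<forall>l0 l1. 0 < l0 \<and> l0 \<le> l1 \<longrightarrow>
     (\<exists>\<alpha> \<beta> :: real. \<alpha> > 0 \<and> \<beta> > 0 \<and> (\<forall>y>0. \<forall>l\<in>{l0..l1}.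
        pos_phi \<Phi> (l * y) \<le> ereal \<alpha> * pos_phi \<Phi> y + ereal (\<beta> * (y + 1)))))"


section \<open>The dual pair, weak topologies and closures\<close>

definition E_Phi :: "'a measure \<Rightarrow> 'a rv_class set \<Rightarrow> (real \<Rightarrow> ereal) \<Rightarrow> 'a rv_class set" where
  "E_Phi P K \<Phi> = (\<Inter>Q\<in>M_Phi P K \<Phi>. L1 P Q)"

definition F_Phi :: "'a measure \<Rightarrow> 'a rv_class set \<Rightarrow> (real \<Rightarrow> ereal) \<Rightarrow> 'a rv_class set" where
  "F_Phi P K \<Phi> = lin_span P (R P ` M_Phi P K \<Phi>)"

definition pairing :: "'a measure \<Rightarrow> 'a rv_class \<Rightarrow> 'a rv_class \<Rightarrow> real" where
  "pairing P z w = (LINT \<omega>|P. rep z \<omega> * rep w \<omega>)"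

text \<open>
  \<open>weak_top P E F\<close> is the coarsest topology on \<open>E\<close> for which \<open>\<lambda>x. pairing P x y\<close> is continuous for
  all \<open>y \<in> F\<close>. Its carrier is \<open>E\<close> whenever \<open>F\<close> is non-empty. As \<open>pairing P\<close> is symmetric,
  the two weak topologies of the dual pair are \<open>weak_top P E F\<close> and \<open>weak_top P F E\<close>.
\<close>

definition weak_top :: "'a measure \<Rightarrow> 'a rv_class set \<Rightarrow> 'a rv_class set \<Rightarrow> 'a rv_class topology" where
  "weak_top P E F = topology_generated_by {{x \<in> E. pairing P x y \<in> U} | y U. y \<in> F \<and> open U}"

definition sol_hull :: "'a measure \<Rightarrow> 'a rv_class set \<Rightarrow> 'a rv_class set \<Rightarrow> 'a rv_class set" where
  "sol_hull P E K = {L0_diff P g y | g y. g \<in> K \<and> y \<in> nonneg_part P E}"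

definition K_Phi :: "'a measure \<Rightarrow> 'a rv_class set \<Rightarrow> (real \<Rightarrow> ereal) \<Rightarrow> 'a rv_class set" where
  "K_Phi P K \<Phi> = sol_hull P (E_Phi P K \<Phi>) K"

definition c_E_Phi :: "'a measure \<Rightarrow> 'a rv_class set \<Rightarrow> (real \<Rightarrow> ereal) \<Rightarrow> 'a rv_class set" where
  "c_E_Phi P K \<Phi> =
     weak_top P (E_Phi P K \<Phi>) (F_Phi P K \<Phi>) closure_of sol_hull P (E_Phi P K \<Phi>) K"

definition L1_closure :: "'a measure \<Rightarrow> 'a measure \<Rightarrow> 'a rv_class set \<Rightarrow> 'a rv_class set" where
  "L1_closure P Q A = {X \<in> L1 P Q. \<exists>Xs :: nat \<Rightarrow> 'a rv_class. (\<forall>n. Xs n \<in> A) \<and>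
     (\<lambda>n. LINT \<omega>|Q. \<bar>rep X \<omega> - rep (Xs n) \<omega>\<bar>) \<longlonglongrightarrow> 0}"

definition C_Phi :: "'a measure \<Rightarrow> 'a rv_class set \<Rightarrow> (real \<Rightarrow> ereal) \<Rightarrow> 'a rv_class set" where
  "C_Phi P K \<Phi> = (\<Inter>Q\<in>M_Phi P K \<Phi>. L1_closure P Q (sol_hull P (L1 P Q) K))"

end

theory Submission
  imports Defs "HOL-Library.Function_Algebras"
begin

text \<open>
  All sets of measures are replaced by sets of densities. If \<open>f\<close> is the density of an element of
  \<open>M_hat_Phi\<close> and \<open>g\<close> that of an element of \<open>M_Phi\<close>, then \<open>u * f + v * g\<close> belongs to \<open>M_Phi\<close> for
  every convex combination with \<open>v > 0\<close>; letting \<open>v\<close> tend to 0 shows that \<open>f\<close> is a weak limit and an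
  element of the span. Conversely, an element of the span is dominated by a multiple of the density
  of some measure in \<open>M_Phi\<close>, so by the growth condition every density of \<open>M1\<close> in the span
  is in \<open>M_hat_Phi\<close>; membership of the cone over \<open>M1\<close> is tested by pairing with indicators and with \<open>K\<close>.
  For \<open>C_Phi\<close>, finitely many elements of the span are dominated by one measure \<open>Q\<close>, so closeness in
  \<open>L1(Q)\<close> gives weak closeness; the other inclusion is a Hahn-Banach separation in \<open>L1(Q)\<close>, whose
  separating functional is a measure dominated by a multiple of \<open>Q\<close>.
\<close>

section \<open>The Hahn-Banach theorem for sublinear functionals\<close>

text \<open>The truncation in \<open>M_hat_Phi\<close> keeps what domination can see. A bound
  \<open>f \<le> c * g\<close> controls \<open>\<Phi>\<close> only at large values; where
  \<open>f\<close> is small, \<open>\<Phi>\<close> may be large, even infinite at 0, and the span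
  may contain such densities. Mixing in a little of some \<open>g\<close> repairs this, because the
  mixture stays above \<open>v * g\<close>. In \<open>C_Phi\<close> the obstacle is that the
  nonnegative part of \<open>L1 P Q\<close> depends on \<open>Q\<close> and need not lie in
  \<open>E\<close>. What matters is the one-sided gap: among all \<open>g - z\<close> with
  \<open>z \<ge> 0\<close>, the one pointwise nearest to \<open>X\<close> is the minimum of
  \<open>g\<close> and \<open>X\<close>, and for \<open>X\<close> in \<open>E\<close> this lies in
  \<open>K - E_+\<close> whichever \<open>Q\<close> is considered. The distance of \<open>X\<close>
  from the solid hull in \<open>L1 P Q\<close> is thus the infimum over \<open>g \<in> K\<close> of
  the integral of \<open>max (X - g) 0\<close>. This gauge is sublinear and lies below the integral
  of the positive part, so every linear functional below it is positive and bounded by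
  \<open>Q\<close>. Hence the form of the Hahn-Banach theorem: a linear functional below a sublinear
  one, with equality at a given point.\<close>

definition sublinear_on :: "'v::real_vector set \<Rightarrow> ('v \<Rightarrow> real) \<Rightarrow> bool" where
  "sublinear_on V p \<longleftrightarrow> (\<forall>x\<in>V. \<forall>y\<in>V. p (x + y) \<le> p x + p y) \<and>
     (\<forall>c\<ge>0. \<forall>x\<in>V. p (c *\<^sub>R x) = c * p x)"

text \<open>Subadditivity of a functional defined by an infimum reduces to this: the left side is
  bounded for every pair of independent choices.\<close>

lemma le_INF_add_INF:
  fixes f :: "'i \<Rightarrow> real" and g :: "'j \<Rightarrow> real"
  assumes "A \<noteq> {}" "B \<noteq> {}" and le: "\<And>a b. a \<in> A \<Longrightarrow> b \<in> B \<Longrightarrow> z \<le> f a + g b"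
  shows "z \<le> (INF a\<in>A. f a) + (INF b\<in>B. g b)"
proof -
  have "z - f a \<le> (INF b\<in>B. g b)" if "a \<in> A" for a
    by (rule cINF_greatest[OF assms(2)]) (use le[OF that] in \<open>simp add: algebra_simps\<close>)
  then have "z - (INF b\<in>B. g b) \<le> (INF a\<in>A. f a)"
    by (intro cINF_greatest[OF assms(1)]) (simp add: algebra_simps)
  then show ?thesis by simp
qed

text \<open>Applying the scaling inequality to \<open>inverse c\<close> reverses it, so one
  direction for positive \<open>c\<close> is enough. The case \<open>c = 0\<close> rests on
  \<open>p 0 = 0\<close>, where subadditivity at 0 gives \<open>0 \<le> p 0\<close>.\<close>

lemma sublinear_onI:
  assumes V: "subspace V"
    and add: "\<And>x y. x \<in> V \<Longrightarrow> y \<in> V \<Longrightarrow> p (x + y) \<le> p x + p y"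
    and scale: "\<And>c x. 0 < c \<Longrightarrow> x \<in> V \<Longrightarrow> p (c *\<^sub>R x) \<le> c * p x"
    and zero: "p 0 \<le> 0"
  shows "sublinear_on V p"
  unfolding sublinear_on_def
proof (intro conjI ballI allI impI)
  fix c :: real and x assume c: "0 \<le> c" and x: "x \<in> V"
  have "0 \<le> p 0"
    using add[of 0 0] subspace_0[OF V] by simp
  with zero have p0: "p 0 = 0" by simp
  show "p (c *\<^sub>R x) = c * p x"
  proof (cases "c = 0")
    case False
    with c have c: "0 < c" by simp
    have "p x = p (inverse c *\<^sub>R (c *\<^sub>R x))"
      using c by simp
    also have "\<dots> \<le> inverse c * p (c *\<^sub>R x)"
      using c by (intro scale subspace_scale[OF V x]) simp
    finally have "c * p x \<le> p (c *\<^sub>R x)"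
      using c by (simp add: field_simps)
    with scale[OF c x] show ?thesis by simp
  qed (simp add: p0)
qed (rule add)

lemma sublinear_on_zero:
  assumes "subspace V" "sublinear_on V p" shows "p 0 = 0"
proof -
  have "p (0 *\<^sub>R 0) = 0 * p 0"
    using assms(2) subspace_0[OF assms(1)] unfolding sublinear_on_def by blast
  then show ?thesis by simp
qed

lemma sublinear_on_lower:
  assumes V: "subspace V" and p: "sublinear_on V p" and x: "x \<in> V"
  shows "- p (- x) \<le> p x"
proof -
  have "p (x + - x) \<le> p x + p (- x)"
    using p x subspace_neg[OF V x] unfolding sublinear_on_def by blast
  then show ?thesis
    using sublinear_on_zero[OF V p] by simp
qed

text \<open>The functional is the infimum of \<open>p (y + t *\<^sub>R x) - t * p x\<close> over
  \<open>t \<ge> 0\<close>: the choice \<open>t = 0\<close> gives \<open>q \<le> p\<close>, and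
  \<open>t = 1\<close> gives the bound at \<open>- x\<close>. A minimal sublinear functional cannot
  be lowered in this way, which forces it to be odd.\<close>

lemma sublinear_on_reduce:
  assumes V: "subspace V" and p: "sublinear_on V p" and x: "x \<in> V"
  obtains q where "sublinear_on V q" "\<And>y. y \<in> V \<Longrightarrow> q y \<le> p y" "q (- x) \<le> - p x"
    "\<And>y. y \<notin> V \<Longrightarrow> q y = 0"
proof
  define q where "q y = (if y \<in> V then INF t\<in>{0..}. p (y + t *\<^sub>R x) - t * p x else 0)" for y
  have padd: "p (a + b) \<le> p a + p b" if "a \<in> V" "b \<in> V" for a b
    using p that unfolding sublinear_on_def by blast
  have pscale: "p (c *\<^sub>R a) = c * p a" if "0 \<le> c" "a \<in> V" for a c
    using p that unfolding sublinear_on_def by blast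
  have bdd: "bdd_below ((\<lambda>t. p (y + t *\<^sub>R x) - t * p x) ` {0..})" if y: "y \<in> V" for y
  proof (rule bdd_belowI2)
    fix t :: real assume t: "t \<in> {0..}"
    have "p (- y + (y + t *\<^sub>R x)) \<le> p (- y) + p (y + t *\<^sub>R x)"
      by (intro padd subspace_add[OF V] subspace_scale[OF V] subspace_neg[OF V] x y)
    then show "- p (- y) \<le> p (y + t *\<^sub>R x) - t * p x"
      using pscale[of t x] x t by simp
  qed
  have qle: "q y \<le> p (y + t *\<^sub>R x) - t * p x" if "y \<in> V" "0 \<le> t" for y t
    unfolding q_def using that by (auto intro!: cINF_lower bdd)
  show "q y \<le> p y" if "y \<in> V" for y
    using qle[OF that, of 0] by simp
  show "q (- x) \<le> - p x"
    using qle[OF subspace_neg[OF V x], of 1] sublinear_on_zero[OF V p] by simp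
  show "q y = 0" if "y \<notin> V" for y
    using that by (simp add: q_def)
  show "sublinear_on V q"
  proof (rule sublinear_onI[OF V])
    fix y z assume y: "y \<in> V" and z: "z \<in> V"
    have "q (y + z) \<le> (p (y + s *\<^sub>R x) - s * p x) + (p (z + t *\<^sub>R x) - t * p x)"
      if st: "s \<in> {0..}" "t \<in> {0..}" for s t
    proof -
      have "q (y + z) \<le> p ((y + z) + (s + t) *\<^sub>R x) - (s + t) * p x"
        using st by (intro qle subspace_add[OF V] y z) simp
      also have "(y + z) + (s + t) *\<^sub>R x = (y + s *\<^sub>R x) + (z + t *\<^sub>R x)"
        by (simp add: algebra_simps)
      also have "p \<dots> \<le> p (y + s *\<^sub>R x) + p (z + t *\<^sub>R x)"
        by (intro padd subspace_add[OF V] subspace_scale[OF V] x y z)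
      finally show ?thesis by (simp add: algebra_simps)
    qed
    then show "q (y + z) \<le> q y + q z"
      unfolding q_def[of y] q_def[of z] if_P[OF y] if_P[OF z]
      by (intro le_INF_add_INF) auto
  next
    fix c :: real and y assume c: "0 < c" and y: "y \<in> V"
    have "q (c *\<^sub>R y) / c \<le> p (y + t *\<^sub>R x) - t * p x" if t: "t \<in> {0..}" for t
    proof -
      have "q (c *\<^sub>R y) \<le> p (c *\<^sub>R y + (c * t) *\<^sub>R x) - (c * t) * p x"
        using t c by (intro qle subspace_scale[OF V] y) simp
      also have "p (c *\<^sub>R y + (c * t) *\<^sub>R x) = c * p (y + t *\<^sub>R x)"
        using c subspace_add[OF V y subspace_scale[OF V x, of t]]
        by (simp flip: pscale add: scaleR_add_right)
      finally show ?thesis using c by (simp add: field_simps)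
    qed
    then have "q (c *\<^sub>R y) / c \<le> q y"
      unfolding q_def[of y] if_P[OF y] by (intro cINF_greatest) auto
    then show "q (c *\<^sub>R y) \<le> c * q y" using c by (simp add: field_simps)
  next
    show "q 0 \<le> 0"
      using qle[OF subspace_0[OF V], of 0] sublinear_on_zero[OF V p] by simp
  qed
qed

text \<open>Zorn's lemma for the reversed pointwise order. Fixing the value 0 off \<open>V\<close>
  keeps arbitrary values outside the subspace from influencing the order or the infima of
  chains.\<close>

lemma minimal_sublinear_on:
  assumes V: "subspace V" and p: "sublinear_on V p" and p0: "\<And>y. y \<notin> V \<Longrightarrow> p y = 0"
  obtains m where "sublinear_on V m" "\<And>y. y \<in> V \<Longrightarrow> m y \<le> p y"
    "\<And>q y. sublinear_on V q \<Longrightarrow> (\<And>z. z \<in> V \<Longrightarrow> q z \<le> m z) \<Longrightarrow> y \<in> V \<Longrightarrow> q y = m y"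
proof -
  define A where "A = {q. sublinear_on V q \<and> (\<forall>y\<in>V. q y \<le> p y) \<and> (\<forall>y. y \<notin> V \<longrightarrow> q y = 0)}"
  define below :: "('a \<Rightarrow> real) \<Rightarrow> ('a \<Rightarrow> real) \<Rightarrow> bool" where "below a b \<longleftrightarrow> (\<forall>x. b x \<le> a x)" for a b
  have "\<exists>m\<in>A. \<forall>a\<in>A. below m a \<longrightarrow> a = m"
  proof (rule predicate_Zorn)
    show "partial_order_on A (relation_of below A)"
      by (rule partial_order_on_relation_ofI) (auto simp: below_def fun_eq_iff intro: order_trans antisym)
  next
    fix C assume C: "C \<in> Chains (relation_of below A)"
    then have CA: "C \<subseteq> A" by (auto simp: Chains_def relation_of_def)
    have tot: "below a b \<or> below b a" if "a \<in> C" "b \<in> C" for a b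
      using C that by (auto simp: Chains_def relation_of_def)
    show "\<exists>u\<in>A. \<forall>a\<in>C. below a u"
    proof (cases "C = {}")
      case True
      then show ?thesis using p p0 by (auto simp: A_def)
    next
      case False
      have sub: "sublinear_on V q" and qp: "y \<in> V \<Longrightarrow> q y \<le> p y" and q0: "y \<notin> V \<Longrightarrow> q y = 0"
        if "q \<in> C" for q y using CA that by (auto simp: A_def)
      define u where "u y = (if y \<in> V then INF q\<in>C. q y else 0)" for y
      have bdd: "bdd_below ((\<lambda>q. q y) ` C)" if y: "y \<in> V" for y
      proof (rule bdd_belowI2)
        fix q assume q: "q \<in> C"
        show "- p (- y) \<le> q y"
          using sublinear_on_lower[OF V sub[OF q] y] qp[OF q subspace_neg[OF V y]] by simp
      qed
      have ule: "u y \<le> q y" if "q \<in> C" for q y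
        unfolding u_def using q0[OF that] that bdd by (auto intro: cINF_lower)
      have "sublinear_on V u"
      proof (rule sublinear_onI[OF V])
        fix y z assume y: "y \<in> V" and z: "z \<in> V"
        have "u (y + z) \<le> a y + b z" if ab: "a \<in> C" "b \<in> C" for a b
        proof -
          \<comment> \<open>Of two members of a chain one lies below the other; the lower one serves
            for both arguments.\<close>
          obtain q where q: "q \<in> C" "q y \<le> a y" "q z \<le> b z"
            using tot[OF ab] ab unfolding below_def by blast
          have "u (y + z) \<le> q (y + z)" by (rule ule) fact
          also have "\<dots> \<le> q y + q z" using sub[OF q(1)] y z by (auto simp: sublinear_on_def)
          finally show ?thesis using q by simp
        qed
        then show "u (y + z) \<le> u y + u z"
          unfolding u_def[of y] u_def[of z] if_P[OF y] if_P[OF z]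
          using False by (intro le_INF_add_INF) auto
      next
        fix c :: real and y assume c: "0 < c" and y: "y \<in> V"
        have "u (c *\<^sub>R y) / c \<le> q y" if q: "q \<in> C" for q
          using ule[OF q, of "c *\<^sub>R y"] sub[OF q] y c by (simp add: sublinear_on_def field_simps)
        then have "u (c *\<^sub>R y) / c \<le> u y"
          unfolding u_def[of y] if_P[OF y] using False by (intro cINF_greatest) auto
        then show "u (c *\<^sub>R y) \<le> c * u y" using c by (simp add: field_simps)
      next
        obtain q where q: "q \<in> C" using False by blast
        show "u 0 \<le> 0"
          using ule[OF q, of 0] sublinear_on_zero[OF V sub[OF q]] by simp
      qed
      moreover have "u y \<le> p y" if "y \<in> V" for y
        using False ule qp that by (meson ex_in_conv order_trans)
      ultimately have "u \<in> A" by (simp add: A_def u_def)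
      then show ?thesis using ule by (auto simp: below_def)
    qed
  qed
  then obtain m where m: "m \<in> A" and min: "\<And>a. a \<in> A \<Longrightarrow> below m a \<Longrightarrow> a = m" by blast
  show ?thesis
  proof (rule that)
    show "sublinear_on V m" "\<And>y. y \<in> V \<Longrightarrow> m y \<le> p y"
      using m by (auto simp: A_def)
  next
    fix q y assume q: "sublinear_on V q" "\<And>z. z \<in> V \<Longrightarrow> q z \<le> m z" and y: "y \<in> V"
    \<comment> \<open>\<open>q\<close> is constrained on \<open>V\<close> only; resetting it to 0
      elsewhere makes it a competitor in \<open>A\<close>.\<close>
    define q' where "q' z = (if z \<in> V then q z else 0)" for z
    have "sublinear_on V q'"
      using q(1) V by (auto simp: sublinear_on_def q'_def subspace_add subspace_scale)
    then have "q' \<in> A"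
      using m q(2) by (fastforce simp: A_def q'_def)
    moreover have "below m q'"
      using m q(2) by (auto simp: below_def q'_def A_def)
    ultimately have "q' = m" by (rule min)
    then show "q y = m y" using y by (metis q'_def)
  qed
qed

text \<open>A minimal sublinear functional is odd, and an odd subadditive functional is additive.
  Lowering \<open>p\<close> along \<open>x\<close> before minimising fixes the value at
  \<open>x\<close>: from \<open>\<phi> (- x) \<le> - p x\<close> and oddness follows
  \<open>p x \<le> \<phi> x\<close>.\<close>

theorem Hahn_Banach_sublinear:
  assumes V: "subspace V" and p: "sublinear_on V p" and x: "x \<in> V"
  obtains \<phi> where "\<And>y z. y \<in> V \<Longrightarrow> z \<in> V \<Longrightarrow> \<phi> (y + z) = \<phi> y + \<phi> z"
    "\<And>c y. y \<in> V \<Longrightarrow> \<phi> (c *\<^sub>R y) = c * \<phi> y" "\<And>y. y \<in> V \<Longrightarrow> \<phi> y \<le> p y" "\<phi> x = p x"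
proof -
  obtain q where q: "sublinear_on V q" "\<And>y. y \<in> V \<Longrightarrow> q y \<le> p y" "q (- x) \<le> - p x"
    "\<And>y. y \<notin> V \<Longrightarrow> q y = 0"
    by (rule sublinear_on_reduce[OF V p x]) blast
  obtain \<phi> where sub: "sublinear_on V \<phi>" and le: "\<And>y. y \<in> V \<Longrightarrow> \<phi> y \<le> q y"
    and min: "\<And>q y. sublinear_on V q \<Longrightarrow> (\<And>z. z \<in> V \<Longrightarrow> q z \<le> \<phi> z) \<Longrightarrow> y \<in> V \<Longrightarrow> q y = \<phi> y"
    by (rule minimal_sublinear_on[OF V q(1,4)]) blast+
  have neg: "\<phi> (- y) = - \<phi> y" if y: "y \<in> V" for y
  proof -
    obtain r where "sublinear_on V r" "\<And>z. z \<in> V \<Longrightarrow> r z \<le> \<phi> z" "r (- y) \<le> - \<phi> y"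
      by (rule sublinear_on_reduce[OF V sub y]) blast
    then have "\<phi> (- y) \<le> - \<phi> y"
      using min[of r "- y"] subspace_neg[OF V y] by simp
    with sublinear_on_lower[OF V sub y] show ?thesis by simp
  qed
  have sadd: "\<phi> (y + z) \<le> \<phi> y + \<phi> z" if "y \<in> V" "z \<in> V" for y z
    using sub that unfolding sublinear_on_def by blast
  show ?thesis
  proof (rule that)
    fix y z assume y: "y \<in> V" and z: "z \<in> V"
    have "\<phi> ((y + z) + - z) \<le> \<phi> (y + z) + \<phi> (- z)"
      by (intro sadd subspace_add[OF V] subspace_neg[OF V] y z)
    then show "\<phi> (y + z) = \<phi> y + \<phi> z"
      using sadd[OF y z] neg[OF z] by simp
  next
    fix c y assume y: "y \<in> V"
    have pos: "\<phi> (c *\<^sub>R y) = c * \<phi> y" if "0 \<le> c" for c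
      using sub that y unfolding sublinear_on_def by blast
    show "\<phi> (c *\<^sub>R y) = c * \<phi> y"
    proof (cases "0 \<le> c")
      case False
      then show ?thesis
        using pos[of "- c"] neg[OF subspace_scale[OF V y, of "- c"]] by simp
    qed (rule pos)
  next
    show "\<phi> y \<le> p y" if "y \<in> V" for y
      using le q(2) that by (meson order_trans)
    show "\<phi> x = p x"
      using le[OF subspace_neg[OF V x]] neg[OF x] q(3) le[OF x] q(2)[OF x] by simp
  qed
qed

text \<open>Pointwise scalar multiplication makes \<open>subspace\<close> and \<open>convex\<close>
  applicable to sets of representatives. The integrable functions form only a subspace of this type,
  which is why the Hahn-Banach theorem above is relative to a subspace.\<close>

instantiation "fun" :: (type, real_vector) real_vector
begin

definition scaleR_fun :: "real \<Rightarrow> ('a \<Rightarrow> 'b) \<Rightarrow> 'a \<Rightarrow> 'b" where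
  "scaleR_fun c f = (\<lambda>x. c *\<^sub>R f x)"

instance
  by standard (auto simp: scaleR_fun_def fun_eq_iff algebra_simps)

end

section \<open>Dominated functionals on integrable functions\<close>

text \<open>The bound by the positive part yields everything: applied to \<open>- f\<close> it gives
  positivity, applied to both signs it gives continuity in the L1 norm, and on indicators it gives a
  set function below \<open>M\<close>. The Radon-Nikodym density of the latter is at most 1, and
  continuity extends the formula from indicators to all integrable functions.\<close>

lemma (in finite_measure) dominated_functional_density:
  fixes \<phi> :: "('a \<Rightarrow> real) \<Rightarrow> real"
  assumes add: "\<And>f g. integrable M f \<Longrightarrow> integrable M g \<Longrightarrow> \<phi> (\<lambda>x. f x + g x) = \<phi> f + \<phi> g"
    and scale: "\<And>c f. integrable M f \<Longrightarrow> \<phi> (\<lambda>x. c * f x) = c * \<phi> f"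
    and le: "\<And>f. integrable M f \<Longrightarrow> \<phi> f \<le> (LINT x|M. max (f x) 0)"
  obtains Z where "Z \<in> borel_measurable M" "\<And>x. 0 \<le> Z x" "\<And>x. Z x \<le> 1"
    "\<And>f. integrable M f \<Longrightarrow> \<phi> f = (LINT x|M. Z x * f x)"
proof -
  have diff: "\<phi> (\<lambda>x. f x - g x) = \<phi> f - \<phi> g" if "integrable M f" "integrable M g" for f g
    using add[OF that(1), of "\<lambda>x. (-1) * g x"] scale[OF that(2), of "-1"] that by simp
  have nonneg: "0 \<le> \<phi> f" if f: "integrable M f" and "\<And>x. 0 \<le> f x" for f
  proof -
    have "max (- f x) 0 = 0" for x
      using that(2)[of x] by simp
    then show ?thesis
      using le[of "\<lambda>x. (-1) * f x"] scale[OF f, of "-1"] f by simp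
  qed
  have abs_le: "\<bar>\<phi> f\<bar> \<le> (LINT x|M. \<bar>f x\<bar>)" if f: "integrable M f" for f
  proof -
    have "(LINT x|M. max (f x) 0) \<le> (LINT x|M. \<bar>f x\<bar>)" "(LINT x|M. max (- f x) 0) \<le> (LINT x|M. \<bar>f x\<bar>)"
      using f by (auto intro!: integral_mono integrable_max)
    with le[OF f] le[of "\<lambda>x. (-1) * f x"] scale[OF f, of "-1"] f show ?thesis by simp
  qed
  have int_ind: "integrable M (indicator A :: 'a \<Rightarrow> real)" if "A \<in> sets M" for A
    using that by (simp add: integrable_indicator_iff emeasure_finite less_top[symmetric])
  define \<mu> where "\<mu> A = \<phi> (indicator A)" for A
  have \<mu>0: "0 \<le> \<mu> A" if "A \<in> sets M" for A
    unfolding \<mu>_def using int_ind[OF that] by (rule nonneg) simp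
  have \<mu>le: "\<mu> A \<le> measure M A" if "A \<in> sets M" for A
    unfolding \<mu>_def using abs_le[OF int_ind[OF that]] that by simp
  have \<mu>diff: "\<mu> (B - A) = \<mu> B - \<mu> A" if "A \<in> sets M" "B \<in> sets M" "A \<subseteq> B" for A B
  proof -
    have "indicator (B - A) = (\<lambda>x. indicator B x - indicator A x :: real)"
      using that(3) by (auto simp: indicator_def fun_eq_iff)
    then show ?thesis unfolding \<mu>_def using that by (simp add: diff int_ind)
  qed
  have \<mu>sums: "(\<lambda>i. \<mu> (A i)) sums \<mu> (\<Union>i. A i)"
    if A: "range A \<subseteq> sets M" and dis: "disjoint_family A" for A :: "nat \<Rightarrow> 'a set"
  proof -
    define B where "B n = (\<Union>i<n. A i)" for n
    have Am: "A i \<in> sets M" for i using A by auto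
    have B: "B n \<in> sets M" for n using Am by (auto simp: B_def)
    have U: "(\<Union>i. A i) \<in> sets M" using Am by auto
    have step: "\<mu> (B (Suc n)) = \<mu> (B n) + \<mu> (A n)" for n
    proof -
      have "A n \<inter> A i = {}" if "i < n" for i
        using dis that by (simp add: disjoint_family_on_def)
      then have "B (Suc n) - B n = A n"
        by (auto simp: less_Suc_eq B_def)
      moreover have "B n \<subseteq> B (Suc n)"
        unfolding B_def by (intro UN_mono) auto
      ultimately show ?thesis
        using \<mu>diff[OF B B, of n "Suc n"] by simp
    qed
    have "\<mu> (B 0) = 0"
      using \<mu>0[of "{}"] \<mu>le[of "{}"] by (simp add: B_def)
    then have "(\<Sum>i<n. \<mu> (A i)) = \<mu> (B n)" for n
      by (induction n) (simp_all add: step)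
    moreover have "(\<lambda>n. \<mu> (B n)) \<longlonglongrightarrow> \<mu> (\<Union>i. A i)"
    proof -
      have "(\<lambda>n. measure M (B n)) \<longlonglongrightarrow> measure M (\<Union>n. B n)"
        using B by (intro finite_Lim_measure_incseq incseq_SucI)
            (auto simp: B_def lessThan_Suc)
      moreover have "(\<Union>n. B n) = (\<Union>i. A i)" by (auto simp: B_def)
      ultimately have lim: "(\<lambda>n. measure M (\<Union>i. A i) - measure M (B n)) \<longlonglongrightarrow> 0"
        by (auto intro: tendsto_eq_intros)
      \<comment> \<open>Countable additivity is inherited from \<open>M\<close>: the remainder after
        \<open>n\<close> sets has smaller \<open>\<mu>\<close>-mass than \<open>M\<close>-mass, and
        the latter tends to 0.\<close>
      have "\<bar>\<mu> (B n) - \<mu> (\<Union>i. A i)\<bar> \<le> measure M (\<Union>i. A i) - measure M (B n)" for n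
      proof -
        have "\<mu> ((\<Union>i. A i) - B n) = \<mu> (\<Union>i. A i) - \<mu> (B n)"
          using U B by (intro \<mu>diff) (auto simp: B_def)
        moreover have "measure M ((\<Union>i. A i) - B n) = measure M (\<Union>i. A i) - measure M (B n)"
          using U B by (intro finite_measure_Diff) (auto simp: B_def)
        moreover have "(\<Union>i. A i) - B n \<in> sets M" using U B by auto
        ultimately show ?thesis
          using \<mu>0[of "(\<Union>i. A i) - B n"] \<mu>le[of "(\<Union>i. A i) - B n"] by simp
      qed
      then show ?thesis
        by (intro LIM_zero_cancel[OF Lim_null_comparison[OF always_eventually lim]]) auto
    qed
    ultimately show ?thesis by (simp add: sums_def)
  qed
  define N where "N = measure_of (space M) (sets M) (\<lambda>A. ennreal (\<mu> A))"
  have N_sets[simp]: "sets N = sets M" by (simp add: N_def)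
  have N_space[simp]: "space N = space M" by (simp add: N_def)
  have emN: "emeasure N A = ennreal (\<mu> A)" if "A \<in> sets M" for A
    unfolding N_def
  proof (rule emeasure_measure_of_sigma[OF _ _ _ that])
    show "sigma_algebra (space M) (sets M)" ..
    show "positive (sets M) (\<lambda>A. ennreal (\<mu> A))"
      using \<mu>le[of "{}"] by (simp add: positive_def ennreal_neg)
    show "countably_additive (sets M) (\<lambda>A. ennreal (\<mu> A))"
    proof (rule countably_additiveI)
      fix A :: "nat \<Rightarrow> 'a set" assume A: "range A \<subseteq> sets M" "disjoint_family A"
      have nn: "0 \<le> \<mu> (A i)" for i using A by (auto intro: \<mu>0)
      then show "(\<Sum>i. ennreal (\<mu> (A i))) = ennreal (\<mu> (\<Union>i. A i))"
        using \<mu>sums[OF A] by (simp add: suminf_ennreal2 sums_iff)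
    qed
  qed
  have N_le: "emeasure N A \<le> emeasure M A" if "A \<in> sets M" for A
    using \<mu>le[OF that] that by (simp add: emN emeasure_eq_measure ennreal_leI)
  have "finite_measure N"
    by (rule finite_measureI) (simp add: emN)
  moreover have "absolutely_continuous M N"
    unfolding absolutely_continuous_def
  proof
    fix A assume A: "A \<in> null_sets M"
    then have "A \<in> sets M" by auto
    with A N_le[OF this] show "A \<in> null_sets N"
      by (simp add: null_sets_def)
  qed
  ultimately obtain f where f[measurable]: "f \<in> borel_measurable M" and fN: "density M f = N"
    using Radon_Nikodym_finite_measure[of N] by auto
  have f_int: "(\<integral>\<^sup>+ x. f x * indicator A x \<partial>M) = ennreal (\<mu> A)" if "A \<in> sets M" for A
    using that fN emN[OF that] by (simp add: emeasure_density[symmetric])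
  have f1: "AE x in M. f x \<le> 1"
  proof -
    \<comment> \<open>On the set where \<open>f\<close> exceeds 1, the integral of
      \<open>f - 1\<close> is \<open>N A\<close> minus \<open>M A\<close>. Since
      \<open>N A \<le> M A\<close> and subtraction in \<open>ennreal\<close> is truncated, this is
      0.\<close>
    define A where "A = {x \<in> space M. 1 < f x}"
    have A[measurable]: "A \<in> sets M" unfolding A_def by measurable
    have "(\<integral>\<^sup>+ x. f x * indicator A x - indicator A x \<partial>M)
        = (\<integral>\<^sup>+ x. f x * indicator A x \<partial>M) - (\<integral>\<^sup>+ x. indicator A x \<partial>M)"
    proof (rule nn_integral_diff)
      show "(\<integral>\<^sup>+ x. indicator A x \<partial>M) \<noteq> \<infinity>"
        by (subst nn_integral_indicator[OF A]) simp
      show "AE x in M. indicator A x \<le> f x * indicator A x"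
        by (intro AE_I2) (simp add: A_def indicator_def less_imp_le)
    qed simp_all
    also have "\<dots> = 0"
      using N_le[OF A] emN[OF A] f_int[OF A] by (simp add: diff_eq_0_ennreal)
    finally have "AE x in M. f x * indicator A x - indicator A x = 0"
      by (subst (asm) nn_integral_0_iff_AE) auto
    with AE_space show ?thesis
    proof eventually_elim
      case (elim x)
      show ?case
      proof (rule ccontr)
        assume "\<not> f x \<le> 1"
        then have "1 < f x" by simp
        with elim show False
          by (auto simp: A_def diff_eq_0_iff_ennreal)
      qed
    qed
  qed
  \<comment> \<open>The truncation makes the bounds 0 and 1 hold at every point; for
    \<open>f\<close> the upper bound is known only almost everywhere.\<close>
  define Z where "Z x = min 1 (enn2real (f x))" for x
  have Z[measurable]: "Z \<in> borel_measurable M" unfolding Z_def by measurable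
  have Z01: "0 \<le> Z x" "Z x \<le> 1" for x by (auto simp: Z_def)
  have Zf: "AE x in M. ennreal (Z x) = f x"
    using f1
  proof eventually_elim
    case (elim x)
    then have "enn2real (f x) \<le> 1" "ennreal (enn2real (f x)) = f x"
      by (auto simp: enn2real_leI ennreal_enn2real_if top_unique)
    then show ?case by (simp add: Z_def min_absorb2)
  qed
  have int_Z: "integrable M (\<lambda>x. Z x * h x)" if "integrable M h" for h :: "'a \<Rightarrow> real"
    using that Z01 by (intro Bochner_Integration.integrable_bound[OF that])
      (auto simp: abs_mult mult_left_le_one_le)
  have Z_ind: "(LINT x|M. Z x * indicator A x) = \<mu> A" if A[measurable]: "A \<in> sets M" for A
  proof -
    have "(LINT x|M. Z x * indicator A x) = enn2real (\<integral>\<^sup>+ x. ennreal (Z x * indicator A x) \<partial>M)"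
      using Z01 by (intro integral_eq_nn_integral) auto
    also have "(\<integral>\<^sup>+ x. ennreal (Z x * indicator A x) \<partial>M) = (\<integral>\<^sup>+ x. f x * indicator A x \<partial>M)"
      by (rule nn_integral_cong_AE) (use Zf in eventually_elim, auto simp: indicator_def)
    finally show ?thesis using \<mu>0[OF A] by (simp add: f_int)
  qed
  have "\<phi> h = (LINT x|M. Z x * h x)" if "integrable M h" for h
    using that
  proof (induction h rule: integrable_induct)
    case (base A c)
    have "\<phi> (\<lambda>x. c * indicator A x) = c * \<mu> A"
      using scale[OF int_ind[OF base(1)]] by (simp add: \<mu>_def)
    also have "\<dots> = (LINT x|M. c * (Z x * indicator A x))"
      by (subst integral_mult_right_zero) (simp add: Z_ind[OF base(1)])
    finally show ?case by (simp add: ac_simps)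
  next
    case (add f g)
    then show ?case using int_Z by (simp add: assms(1) distrib_left)
  next
    case (lim f s)
    have int_diff: "integrable M (\<lambda>x. s i x - f x)" for i using lim by simp
    \<comment> \<open>The simple approximants satisfy
      \<open>\<bar>s i x\<bar> \<le> 2 * \<bar>f x\<bar>\<close>, so
      \<open>3 * \<bar>f x\<bar>\<close> dominates the differences.\<close>
    have L1: "(\<lambda>i. LINT x|M. \<bar>s i x - f x\<bar>) \<longlonglongrightarrow> (LINT x|M. 0)"
    proof (rule integral_dominated_convergence)
      show "AE x in M. (\<lambda>i. \<bar>s i x - f x\<bar>) \<longlonglongrightarrow> 0"
        using lim by (intro AE_I2 tendsto_rabs_zero LIM_zero) simp
      show "AE x in M. norm \<bar>s i x - f x\<bar> \<le> 3 * \<bar>f x\<bar>" for i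
      proof (rule AE_I2)
        fix x assume "x \<in> space M"
        then have "\<bar>s i x\<bar> \<le> 2 * \<bar>f x\<bar>" using lim.hyps(3) by auto
        then show "norm \<bar>s i x - f x\<bar> \<le> 3 * \<bar>f x\<bar>" by simp
      qed
    qed (use lim in auto)
    have "(\<lambda>i. \<phi> (s i)) \<longlonglongrightarrow> \<phi> f"
    proof (rule LIM_zero_cancel, rule Lim_null_comparison)
      show "\<forall>\<^sub>F i in sequentially. norm (\<phi> (s i) - \<phi> f) \<le> (LINT x|M. \<bar>s i x - f x\<bar>)"
        using abs_le[OF int_diff] lim by (simp add: diff)
    qed (use L1 in simp)
    moreover have "(\<lambda>i. LINT x|M. Z x * s i x) \<longlonglongrightarrow> (LINT x|M. Z x * f x)"
    proof (rule LIM_zero_cancel, rule Lim_null_comparison)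
      have "norm ((LINT x|M. Z x * s i x) - (LINT x|M. Z x * f x)) \<le> (LINT x|M. \<bar>s i x - f x\<bar>)" for i
      proof -
        have "(LINT x|M. Z x * s i x) - (LINT x|M. Z x * f x) = (LINT x|M. Z x * (s i x - f x))"
          using int_Z lim by (simp add: right_diff_distrib)
        also have "norm \<dots> \<le> (LINT x|M. norm (Z x * (s i x - f x)))"
          by (rule integral_norm_bound)
        also have "\<dots> \<le> (LINT x|M. \<bar>s i x - f x\<bar>)"
          using int_Z[OF int_diff] int_Z[OF integrable_abs[OF int_diff]] int_diff Z01
          by (intro integral_mono) (auto simp: abs_mult mult_left_le_one_le)
        finally show ?thesis .
      qed
      then show "\<forall>\<^sub>F i in sequentially.
          norm ((LINT x|M. Z x * s i x) - (LINT x|M. Z x * f x)) \<le> (LINT x|M. \<bar>s i x - f x\<bar>)"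
        by simp
    qed (use L1 in simp)
    ultimately show ?case
      using lim.IH by (simp add: LIMSEQ_unique)
  qed
  with Z Z01 show ?thesis by (rule that)
qed

section \<open>Closures in weak topologies\<close>

lemma topspace_weak_top:
  assumes "F \<noteq> {}"
  shows "topspace (weak_top P E F) = E"
proof -
  obtain y where "y \<in> F" using assms by blast
  then have "E \<in> {{x \<in> E. pairing P x y \<in> U} | y U. y \<in> F \<and> open U}"
    by (intro CollectI exI[of _ y] exI[of _ UNIV]) simp
  then show ?thesis
    unfolding weak_top_def topology_generated_by_topspace by blast
qed

lemma openin_weak_top:
  "y \<in> F \<Longrightarrow> open U \<Longrightarrow> openin (weak_top P E F) {x \<in> E. pairing P x y \<in> U}"
  unfolding weak_top_def by (intro topology_generated_by_Basis CollectI exI[of _ y] exI[of _ U]) simp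

text \<open>The points whose pairing with \<open>y\<close> falls outside \<open>C\<close> form a
  subbasic open set that misses \<open>A\<close>. This is how signs, inequalities against
  \<open>K\<close> and the total mass pass to a weak limit.\<close>

lemma weak_closure_pairing:
  assumes x: "x \<in> weak_top P E F closure_of A" and y: "y \<in> F"
    and C: "closed C" "\<And>a. a \<in> A \<Longrightarrow> pairing P a y \<in> C"
  shows "pairing P x y \<in> C"
proof (rule ccontr)
  assume n: "pairing P x y \<notin> C"
  have xE: "x \<in> E"
    using x y topspace_weak_top[of F P E] unfolding in_closure_of by blast
  have op: "openin (weak_top P E F) {x \<in> E. pairing P x y \<in> - C}"
    using y C(1) by (intro openin_weak_top) auto
  have "\<exists>a. a \<in> A \<and> a \<in> T" if "x \<in> T" "openin (weak_top P E F) T" for T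
    using x that unfolding in_closure_of by simp
  from this[OF _ op] obtain a where "a \<in> A" "pairing P a y \<in> - C"
    using n xE by auto
  with C(2) show False by blast
qed

text \<open>A neighbourhood in the generated topology constrains only finitely many pairings: the
  finite sets are united at an intersection and inherited from one member at a union. The
  formulation by sequences makes the induction over generated open sets direct.\<close>

lemma weak_open_sequential:
  assumes "openin (weak_top P E F) T" "x \<in> T"
  shows "\<exists>Y. finite Y \<and> Y \<subseteq> F \<and> (\<forall>a. (\<forall>n. a n \<in> E) \<and>
    (\<forall>y\<in>Y. (\<lambda>n. pairing P (a n) y) \<longlonglongrightarrow> pairing P x y) \<longrightarrow> (\<forall>\<^sub>F n in sequentially. a n \<in> T))"
proof -
  define conv where "conv Y a \<longleftrightarrow> (\<forall>n. a n \<in> E) \<and>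
    (\<forall>y\<in>Y. (\<lambda>n. pairing P (a n) y) \<longlonglongrightarrow> pairing P x y)" for Y a
  have "generate_topology_on {{x \<in> E. pairing P x y \<in> U} | y U. y \<in> F \<and> open U} T"
    using assms(1) unfolding weak_top_def by (rule openin_topology_generated_by)
  then show ?thesis using assms(2)
    unfolding conv_def[symmetric]
  proof (induction T)
    case Empty
    then show ?case by simp
  next
    case (Int S T)
    then obtain Y Y' where Y: "finite Y" "Y \<subseteq> F" "finite Y'" "Y' \<subseteq> F" and
      ev: "\<And>a. conv Y a \<Longrightarrow> (\<forall>\<^sub>F n in sequentially. a n \<in> S)"
      "\<And>a. conv Y' a \<Longrightarrow> (\<forall>\<^sub>F n in sequentially. a n \<in> T)" by blast
    have "\<forall>\<^sub>F n in sequentially. a n \<in> S \<inter> T" if "conv (Y \<union> Y') a" for a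
    proof -
      have "conv Y a" "conv Y' a" using that by (simp_all add: conv_def)
      from ev(1)[OF this(1)] ev(2)[OF this(2)] show ?thesis
        by eventually_elim simp
    qed
    with Y show ?case
      by (intro exI[of _ "Y \<union> Y'"]) simp
  next
    case (UN K)
    then obtain k where k: "k \<in> K" "x \<in> k" by blast
    from UN.IH[OF k] obtain Y where Y: "finite Y" "Y \<subseteq> F" and
      ev: "\<And>a. conv Y a \<Longrightarrow> (\<forall>\<^sub>F n in sequentially. a n \<in> k)" by blast
    have "\<forall>\<^sub>F n in sequentially. a n \<in> \<Union> K" if "conv Y a" for a
      using ev[OF that] by (rule eventually_mono) (rule UnionI[OF k(1)])
    with Y show ?case by blast
  next
    case (Basis s)
    then obtain y U where s: "s = {x \<in> E. pairing P x y \<in> U}" "y \<in> F" "open U" by auto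
    have "\<forall>\<^sub>F n in sequentially. a n \<in> s" if "conv {y} a" for a
    proof -
      have "\<forall>\<^sub>F n in sequentially. pairing P (a n) y \<in> U"
        using that s Basis.prems by (intro topological_tendstoD[of _ "pairing P x y"]) (simp_all add: conv_def)
      then show ?thesis
        by eventually_elim (use that in \<open>simp add: conv_def s\<close>)
    qed
    with s(2) show ?case
      by (intro exI[of _ "{y}"]) simp
  qed
qed

text \<open>The sequence may depend on the finite set \<open>Y\<close>. Sequences therefore suffice
  even where no single one converges for all pairings.\<close>

lemma weak_closureI:
  assumes "F \<noteq> {}" "x \<in> E" "A \<subseteq> E"
    and seq: "\<And>Y. finite Y \<Longrightarrow> Y \<subseteq> F \<Longrightarrow>
      \<exists>a. (\<forall>n::nat. a n \<in> A) \<and> (\<forall>y\<in>Y. (\<lambda>n. pairing P (a n) y) \<longlonglongrightarrow> pairing P x y)"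
  shows "x \<in> weak_top P E F closure_of A"
  unfolding in_closure_of topspace_weak_top[OF assms(1)]
proof (intro conjI allI impI)
  show "x \<in> E" by fact
  fix T assume T: "x \<in> T \<and> openin (weak_top P E F) T"
  obtain Y where Y: "finite Y" "Y \<subseteq> F" and ev: "\<And>a. (\<forall>n. a n \<in> E) \<Longrightarrow>
      (\<forall>y\<in>Y. (\<lambda>n. pairing P (a n) y) \<longlonglongrightarrow> pairing P x y) \<Longrightarrow> \<forall>\<^sub>F n in sequentially. a n \<in> T"
    using weak_open_sequential[of P E F T x] T by metis
  obtain a where a: "\<forall>n::nat. a n \<in> A" "\<forall>y\<in>Y. (\<lambda>n. pairing P (a n) y) \<longlonglongrightarrow> pairing P x y"
    using seq[OF Y] by blast
  then have "\<forall>\<^sub>F n in sequentially. a n \<in> T"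
    using assms(3) by (intro ev) auto
  then obtain n where "a n \<in> T"
    using eventually_happens'[OF sequentially_bot] by blast
  with a(1) show "\<exists>y. y \<in> A \<and> y \<in> T" by blast
qed

text \<open>The hypothesis \<open>far\<close> says that \<open>f\<close> has distance at least
  \<open>e\<close> from \<open>G\<close> minus the nonnegative functions, since subtracting the best
  nonnegative function from \<open>g\<close> leaves the error \<open>max (f - g) 0\<close>.\<close>

lemma (in finite_measure) convex_cone_separation:
  fixes G :: "('a \<Rightarrow> real) set" and e :: real
  assumes G: "\<And>g. g \<in> G \<Longrightarrow> integrable M g"
    and zero: "(\<lambda>\<omega>. 0) \<in> G"
    and add: "\<And>g h. g \<in> G \<Longrightarrow> h \<in> G \<Longrightarrow> (\<lambda>\<omega>. g \<omega> + h \<omega>) \<in> G"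
    and scale: "\<And>c g. 0 < c \<Longrightarrow> g \<in> G \<Longrightarrow> (\<lambda>\<omega>. c * g \<omega>) \<in> G"
    and f: "integrable M f" and e: "0 < e"
    and far: "\<And>g. g \<in> G \<Longrightarrow> e \<le> (LINT \<omega>|M. max (f \<omega> - g \<omega>) 0)"
  obtains Z where "Z \<in> borel_measurable M" "\<And>\<omega>. 0 \<le> Z \<omega>" "\<And>\<omega>. Z \<omega> \<le> 1"
    "\<And>g. g \<in> G \<Longrightarrow> (LINT \<omega>|M. Z \<omega> * g \<omega>) \<le> 0" "0 < (LINT \<omega>|M. Z \<omega> * f \<omega>)"
proof -
  define V :: "('a \<Rightarrow> real) set" where "V = {h. integrable M h}"
  define d :: "('a \<Rightarrow> real) \<Rightarrow> ('a \<Rightarrow> real) \<Rightarrow> real" where "d h g = (LINT \<omega>|M. max (h \<omega> - g \<omega>) 0)" for h g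
  \<comment> \<open>This gauge is sublinear because \<open>G\<close> is a convex cone, lies below
    the integral of the positive part because \<open>0 \<in> G\<close>, is at most 0 on
    \<open>G\<close>, and is at least \<open>e\<close> at \<open>f\<close>. A linear functional
    below it that agrees with it at \<open>f\<close> therefore separates.\<close>
  define p where "p h = (INF g\<in>G. d h g)" for h
  have V: "subspace V"
    by (auto simp: subspace_def V_def plus_fun_def zero_fun_def scaleR_fun_def)
  have ne: "G \<noteq> {}" using zero by blast
  have d0: "0 \<le> d h g" for h g
    unfolding d_def by (rule integral_nonneg_AE) simp
  have p_le: "p h \<le> d h g" if "g \<in> G" for h g
    unfolding p_def using that by (intro cINF_lower bdd_belowI2[of _ 0] d0)
  have dint: "integrable M (\<lambda>\<omega>. max (h \<omega> - g \<omega>) 0)" if "h \<in> V" "g \<in> G" for h g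
    using that G by (intro integrable_max) (auto simp: V_def)
  have "sublinear_on V p"
  proof (rule sublinear_onI[OF V])
    fix h k assume hk: "h \<in> V" "k \<in> V"
    have "p (h + k) \<le> d h a + d k b" if ab: "a \<in> G" "b \<in> G" for a b
    proof -
      have "p (h + k) \<le> d (h + k) (\<lambda>\<omega>. a \<omega> + b \<omega>)"
        by (rule p_le[OF add[OF ab]])
      also have "\<dots> \<le> (LINT \<omega>|M. max (h \<omega> - a \<omega>) 0 + max (k \<omega> - b \<omega>) 0)"
        unfolding d_def
        using hk ab by (intro integral_mono dint add Bochner_Integration.integrable_add subspace_add[OF V]) auto
      also have "\<dots> = d h a + d k b"
        unfolding d_def by (intro Bochner_Integration.integral_add dint hk ab)
      finally show ?thesis .
    qed
    then show "p (h + k) \<le> p h + p k"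
      unfolding p_def[of h] p_def[of k] by (intro le_INF_add_INF ne)
  next
    fix c :: real and h assume c: "0 < c" and h: "h \<in> V"
    have "p (c *\<^sub>R h) / c \<le> d h g" if g: "g \<in> G" for g
    proof -
      have "p (c *\<^sub>R h) \<le> d (c *\<^sub>R h) (\<lambda>\<omega>. c * g \<omega>)"
        by (rule p_le[OF scale[OF c g]])
      also have "\<dots> = (LINT \<omega>|M. c * max (h \<omega> - g \<omega>) 0)"
        unfolding d_def using c
        by (intro Bochner_Integration.integral_cong)
          (auto simp: scaleR_fun_def max_mult_distrib_left algebra_simps max_def)
      also have "\<dots> = c * d h g" unfolding d_def by simp
      finally show ?thesis using c by (simp add: field_simps)
    qed
    then have "p (c *\<^sub>R h) / c \<le> p h"
      unfolding p_def[of h] by (intro cINF_greatest ne)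
    then show "p (c *\<^sub>R h) \<le> c * p h" using c by (simp add: field_simps)
  next
    show "p 0 \<le> 0"
      using p_le[OF zero, of 0] by (simp add: d_def)
  qed
  moreover have "f \<in> V" using f by (simp add: V_def)
  ultimately obtain \<phi> where \<phi>_add: "\<And>h k. h \<in> V \<Longrightarrow> k \<in> V \<Longrightarrow> \<phi> (h + k) = \<phi> h + \<phi> k"
    and \<phi>_scale: "\<And>c h. h \<in> V \<Longrightarrow> \<phi> (c *\<^sub>R h) = c * \<phi> h"
    and \<phi>_le: "\<And>h. h \<in> V \<Longrightarrow> \<phi> h \<le> p h" and \<phi>_f: "\<phi> f = p f"
    using Hahn_Banach_sublinear[OF V] by metis
  have "\<exists>Z. Z \<in> borel_measurable M \<and> (\<forall>\<omega>. 0 \<le> Z \<omega>) \<and> (\<forall>\<omega>. Z \<omega> \<le> 1) \<and>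
    (\<forall>h. integrable M h \<longrightarrow> \<phi> h = (LINT \<omega>|M. Z \<omega> * h \<omega>))"
  proof (rule dominated_functional_density[of \<phi>])
    show "\<phi> (\<lambda>\<omega>. h \<omega> + k \<omega>) = \<phi> h + \<phi> k" if "integrable M h" "integrable M k" for h k
      using \<phi>_add[of h k] that by (simp add: V_def plus_fun_def)
    show "\<phi> (\<lambda>\<omega>. c * h \<omega>) = c * \<phi> h" if "integrable M h" for c h
      using \<phi>_scale[of h c] that by (simp add: V_def scaleR_fun_def)
    show "\<phi> h \<le> (LINT \<omega>|M. max (h \<omega>) 0)" if "integrable M h" for h
      using order_trans[OF \<phi>_le p_le[OF zero], of h] that by (simp add: V_def d_def)
  qed blast
  then obtain Z where Z: "Z \<in> borel_measurable M" "\<And>\<omega>. 0 \<le> Z \<omega>" "\<And>\<omega>. Z \<omega> \<le> 1"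
    and \<phi>_Z: "\<And>h. integrable M h \<Longrightarrow> \<phi> h = (LINT \<omega>|M. Z \<omega> * h \<omega>)" by blast
  show ?thesis
  proof (rule that[OF Z])
    fix g assume g: "g \<in> G"
    have "\<phi> g \<le> d g g"
      using \<phi>_le p_le[OF g] G[OF g] by (auto simp: V_def intro: order_trans)
    then show "(LINT \<omega>|M. Z \<omega> * g \<omega>) \<le> 0"
      using \<phi>_Z[OF G[OF g]] by (simp add: d_def)
  next
    have "e \<le> p f"
      unfolding p_def using far by (intro cINF_greatest ne) (simp add: d_def)
    then show "0 < (LINT \<omega>|M. Z \<omega> * f \<omega>)"
      using \<phi>_f \<phi>_Z[OF f] e by simp
  qed
qed

section \<open>Representatives of classes\<close>

lemma ae_class_eqI:
  assumes "f \<in> borel_measurable P" "g \<in> borel_measurable P" "AE \<omega> in P. f \<omega> = g \<omega>"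
  shows "ae_class P f = ae_class P g"
  unfolding ae_class_def
  by (rule equiv_class_eq[OF equiv_ae_rel]) (simp add: ae_rel_def assms)

lemma L0_scale_ae_class:
  assumes [measurable]: "f \<in> borel_measurable P"
  shows "L0_scale P c (ae_class P f) = ae_class P (\<lambda>\<omega>. c * f \<omega>)"
proof -
  have [measurable]: "rep (ae_class P f) \<in> borel_measurable P"
    by (intro rep_measurable ae_class_in_L0 assms)
  show ?thesis
    unfolding L0_scale_def
    by (rule ae_class_eqI) (use rep_ae_class[OF assms] in \<open>auto elim!: eventually_mono\<close>)
qed

lemma L0_add_ae_class:
  assumes [measurable]: "f \<in> borel_measurable P" "g \<in> borel_measurable P"
  shows "L0_add P (ae_class P f) (ae_class P g) = ae_class P (\<lambda>\<omega>. f \<omega> + g \<omega>)"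
proof -
  have [measurable]: "rep (ae_class P f) \<in> borel_measurable P" "rep (ae_class P g) \<in> borel_measurable P"
    by (intro rep_measurable ae_class_in_L0 assms)+
  have "AE \<omega> in P. rep (ae_class P f) \<omega> + rep (ae_class P g) \<omega> = f \<omega> + g \<omega>"
    using rep_ae_class[OF assms(1)] rep_ae_class[OF assms(2)] by eventually_elim simp
  then show ?thesis
    unfolding L0_add_def by (intro ae_class_eqI) auto
qed

lemma wedge_add:
  assumes K: "wedge P K" and X: "X \<in> K" and Y: "Y \<in> K"
  shows "ae_class P (\<lambda>\<omega>. rep X \<omega> + rep Y \<omega>) \<in> K"
proof -
  have [measurable]: "rep X \<in> borel_measurable P" "rep Y \<in> borel_measurable P"
    using K X Y by (auto simp: wedge_def intro: rep_measurable)
  \<comment> \<open>The sum is twice the midpoint, which turns convexity and scaling into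
    additivity.\<close>
  let ?Z = "L0_add P (L0_scale P (1 - 1/2) X) (L0_scale P (1/2) Y)"
  have "\<forall>t\<in>{0..1}. L0_add P (L0_scale P (1 - t) X) (L0_scale P t Y) \<in> K"
    using K X Y unfolding wedge_def by blast
  then have "?Z \<in> K" by (rule bspec) simp
  then have "L0_scale P 2 ?Z \<in> K" using K unfolding wedge_def by simp
  also have "L0_scale P 2 ?Z = ae_class P (\<lambda>\<omega>. rep X \<omega> + rep Y \<omega>)"
    by (simp add: L0_scale_def[of _ _ X] L0_scale_def[of _ _ Y] L0_add_ae_class L0_scale_ae_class
        algebra_simps)
  finally show ?thesis .
qed

lemma wedge_scale: "wedge P K \<Longrightarrow> X \<in> K \<Longrightarrow> 0 \<le> c \<Longrightarrow> ae_class P (\<lambda>\<omega>. c * rep X \<omega>) \<in> K"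
  unfolding wedge_def L0_scale_def by simp

lemma wedge_zero:
  assumes "wedge P K" shows "ae_class P (\<lambda>\<omega>. 0) \<in> K"
proof -
  obtain X where "X \<in> K" using assms by (auto simp: wedge_def)
  from wedge_scale[OF assms this, of 0] show ?thesis by simp
qed

section \<open>Wedges and spans generated by convex sets of functions\<close>

lemma convex_funI:
  fixes D :: "('a \<Rightarrow> real) set"
  assumes "\<And>f g u v. f \<in> D \<Longrightarrow> g \<in> D \<Longrightarrow> 0 \<le> u \<Longrightarrow> 0 \<le> v \<Longrightarrow> u + v = 1 \<Longrightarrow>
    (\<lambda>\<omega>. u * f \<omega> + v * g \<omega>) \<in> D"
  shows "convex D"
  unfolding convex_def using assms by (simp add: plus_fun_def scaleR_fun_def)

lemma convex_funD:
  fixes D :: "('a \<Rightarrow> real) set"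
  assumes "convex D" "f \<in> D" "g \<in> D" "0 \<le> u" "0 \<le> v" "u + v = 1"
  shows "(\<lambda>\<omega>. u * f \<omega> + v * g \<omega>) \<in> D"
  using convexD[OF assms] by (simp add: plus_fun_def scaleR_fun_def)

text \<open>Normalising the coefficients to \<open>a / (a + b)\<close> and
  \<open>b / (a + b)\<close> merges two terms into one. This gives the explicit form of wedges and
  spans below, and it combines several dominating densities into a single one.\<close>

lemma convex_fun_cone:
  fixes D :: "('a \<Rightarrow> real) set"
  assumes D: "convex D" and f: "f \<in> D" and g: "g \<in> D" and ab: "0 \<le> a" "0 \<le> b"
  obtains h where "h \<in> D" "\<And>\<omega>. a * f \<omega> + b * g \<omega> = (a + b) * h \<omega>"
proof (cases "a + b = 0")
  case True
  with ab have "a = 0" "b = 0" by auto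
  with f show ?thesis using that[of f] by simp
next
  case False
  have "(\<lambda>\<omega>. a / (a + b) * f \<omega> + b / (a + b) * g \<omega>) \<in> D"
    using ab False by (intro convex_funD[OF D f g]) (auto simp: add_divide_distrib[symmetric])
  then show ?thesis
    by (rule that) (use False in \<open>simp add: distrib_left\<close>)
qed

text \<open>Convexity of \<open>D\<close> lets a sum of multiples collapse to a multiple of one
  element, so the multiples already form a wedge.\<close>

lemma wedge_hull_ae_class:
  assumes D: "convex D" "D \<noteq> {}" "D \<subseteq> borel_measurable P"
  shows "wedge_hull P (ae_class P ` D) = {ae_class P (\<lambda>\<omega>. c * f \<omega>) | c f. 0 \<le> c \<and> f \<in> D}"
    (is "_ = ?W")
proof
  have [measurable]: "f \<in> borel_measurable P" if "f \<in> D" for f using D that by auto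
  have "wedge P ?W"
    unfolding wedge_def
  proof (intro conjI ballI allI impI)
    show "?W \<subseteq> L0 P" by (auto intro!: ae_class_in_L0)
    show "?W \<noteq> {}" using D(2) by (auto intro: exI[of _ 0])
  next
    fix X Y :: "'a rv_class" and t :: real assume X: "X \<in> ?W" and Y: "Y \<in> ?W" and t: "t \<in> {0..1}"
    obtain c f where c: "0 \<le> c" "f \<in> D" "X = ae_class P (\<lambda>\<omega>. c * f \<omega>)" using X by auto
    obtain d g where d: "0 \<le> d" "g \<in> D" "Y = ae_class P (\<lambda>\<omega>. d * g \<omega>)" using Y by auto
    obtain h where h: "h \<in> D" "\<And>\<omega>. ((1 - t) * c) * f \<omega> + (t * d) * g \<omega> = ((1 - t) * c + t * d) * h \<omega>"
      by (rule convex_fun_cone[OF D(1) c(2) d(2), of "(1 - t) * c" "t * d"]) (use c d t in auto)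
    have "L0_add P (L0_scale P (1 - t) X) (L0_scale P t Y) = ae_class P (\<lambda>\<omega>. ((1 - t) * c + t * d) * h \<omega>)"
      using c(2) d(2) h(1) by (simp add: c d L0_add_ae_class L0_scale_ae_class h(2)[symmetric] mult.assoc)
    moreover have "0 \<le> (1 - t) * c + t * d" using c d t by auto
    ultimately show "L0_add P (L0_scale P (1 - t) X) (L0_scale P t Y) \<in> ?W" using h(1) by blast
  next
    fix X :: "'a rv_class" and a :: real assume X: "X \<in> ?W" and a: "0 \<le> a"
    obtain c f where c: "0 \<le> c" "f \<in> D" "X = ae_class P (\<lambda>\<omega>. c * f \<omega>)" using X by auto
    then have "L0_scale P a X = ae_class P (\<lambda>\<omega>. (a * c) * f \<omega>)"
      by (simp add: L0_scale_ae_class mult.assoc)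
    moreover have "0 \<le> a * c" using a c by simp
    ultimately show "L0_scale P a X \<in> ?W" using c(2) by blast
  qed
  moreover have "ae_class P ` D \<subseteq> ?W"
  proof
    fix X assume "X \<in> ae_class P ` D"
    then obtain f where "f \<in> D" "X = ae_class P (\<lambda>\<omega>. 1 * f \<omega>)" by auto
    then show "X \<in> ?W" using zero_le_one by blast
  qed
  ultimately show "wedge_hull P (ae_class P ` D) \<subseteq> ?W"
    unfolding wedge_hull_def by (intro Inter_lower) simp
  show "?W \<subseteq> wedge_hull P (ae_class P ` D)"
  proof
    fix X assume "X \<in> ?W"
    then obtain c f where c: "0 \<le> c" "f \<in> D" "X = ae_class P (\<lambda>\<omega>. c * f \<omega>)" by auto
    have "X \<in> C" if "wedge P C" "ae_class P ` D \<subseteq> C" for C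
    proof -
      have "L0_scale P c (ae_class P f) \<in> C" using that c unfolding wedge_def by blast
      then show ?thesis using c by (simp add: L0_scale_ae_class)
    qed
    then show "X \<in> wedge_hull P (ae_class P ` D)" unfolding wedge_hull_def by blast
  qed
qed

text \<open>The positive and the negative terms of a linear combination are merged separately, so a
  difference of two multiples is enough.\<close>

lemma lin_span_ae_class:
  assumes D: "convex D" "D \<noteq> {}" "D \<subseteq> borel_measurable P"
  shows "lin_span P (ae_class P ` D) =
    {ae_class P (\<lambda>\<omega>. a * f \<omega> - b * g \<omega>) | a b f g. 0 \<le> a \<and> 0 \<le> b \<and> f \<in> D \<and> g \<in> D}"
    (is "_ = ?V")
proof
  have [measurable]: "f \<in> borel_measurable P" if "f \<in> D" for f using D that by auto
  obtain f0 where f0: "f0 \<in> D" using D(2) by blast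
  have VI: "ae_class P (\<lambda>\<omega>. a * f \<omega> - b * g \<omega>) \<in> ?V"
    if "0 \<le> a" "0 \<le> b" "f \<in> D" "g \<in> D" for a b f g using that by blast
  have "lin_subspace P ?V"
    unfolding lin_subspace_def
  proof (intro conjI ballI allI impI)
    show "?V \<subseteq> L0 P" by (auto intro!: ae_class_in_L0)
    show "L0_zero P \<in> ?V" using VI[of 0 0 f0 f0] f0 by (simp add: L0_zero_def)
  next
    fix X Y assume X: "X \<in> ?V" and Y: "Y \<in> ?V"
    obtain a b f g where X: "0 \<le> a" "0 \<le> b" "f \<in> D" "g \<in> D" "X = ae_class P (\<lambda>\<omega>. a * f \<omega> - b * g \<omega>)"
      using X by auto
    obtain a' b' f' g' where Y: "0 \<le> a'" "0 \<le> b'" "f' \<in> D" "g' \<in> D"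
      "Y = ae_class P (\<lambda>\<omega>. a' * f' \<omega> - b' * g' \<omega>)"
      using Y by auto
    obtain h where h: "h \<in> D" "\<And>\<omega>. a * f \<omega> + a' * f' \<omega> = (a + a') * h \<omega>"
      by (rule convex_fun_cone[OF D(1) X(3) Y(3) X(1) Y(1)]) blast
    obtain k where k: "k \<in> D" "\<And>\<omega>. b * g \<omega> + b' * g' \<omega> = (b + b') * k \<omega>"
      by (rule convex_fun_cone[OF D(1) X(4) Y(4) X(2) Y(2)]) blast
    have "(a * f \<omega> - b * g \<omega>) + (a' * f' \<omega> - b' * g' \<omega>) = (a + a') * h \<omega> - (b + b') * k \<omega>" for \<omega>
      using h(2)[of \<omega>] k(2)[of \<omega>] by linarith
    then have "L0_add P X Y = ae_class P (\<lambda>\<omega>. (a + a') * h \<omega> - (b + b') * k \<omega>)"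
      using X(3,4) Y(3,4) by (simp add: X Y L0_add_ae_class)
    then show "L0_add P X Y \<in> ?V" using VI[OF _ _ h(1) k(1)] X Y by simp
  next
    fix X c assume X: "X \<in> ?V"
    obtain a b f g where X: "0 \<le> a" "0 \<le> b" "f \<in> D" "g \<in> D" "X = ae_class P (\<lambda>\<omega>. a * f \<omega> - b * g \<omega>)"
      using X by auto
    have eq: "L0_scale P c X = ae_class P (\<lambda>\<omega>. c * (a * f \<omega> - b * g \<omega>))"
      using X by (simp add: L0_scale_ae_class)
    show "L0_scale P c X \<in> ?V"
    proof (cases "0 \<le> c")
      case True
      then show ?thesis using VI[of "c * a" "c * b" f g] X eq by (simp add: algebra_simps)
    next
      case False
      \<comment> \<open>A negative scalar exchanges the two parts, so both coefficients stay
        nonnegative.\<close>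
      then have "0 \<le> - c * b" "0 \<le> - c * a" using X by (auto intro: mult_nonpos_nonneg)
      from VI[OF this X(4,3)] eq show ?thesis by (simp add: algebra_simps)
    qed
  qed
  moreover have "ae_class P ` D \<subseteq> ?V"
  proof
    fix X assume "X \<in> ae_class P ` D"
    then obtain f where "f \<in> D" "X = ae_class P (\<lambda>\<omega>. 1 * f \<omega> - 0 * f \<omega>)" by auto
    then show "X \<in> ?V" using VI[of 1 0 f f] by simp
  qed
  ultimately show "lin_span P (ae_class P ` D) \<subseteq> ?V"
    unfolding lin_span_def by (intro Inter_lower) simp
  show "?V \<subseteq> lin_span P (ae_class P ` D)"
  proof
    fix X assume "X \<in> ?V"
    then obtain a b f g where X: "f \<in> D" "g \<in> D" "X = ae_class P (\<lambda>\<omega>. a * f \<omega> - b * g \<omega>)" by auto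
    have "X \<in> V" if "lin_subspace P V" "ae_class P ` D \<subseteq> V" for V
    proof -
      have "L0_add P (L0_scale P a (ae_class P f)) (L0_scale P (- b) (ae_class P g)) \<in> V"
        using that X unfolding lin_subspace_def by blast
      then show ?thesis using X by (simp add: L0_scale_ae_class L0_add_ae_class)
    qed
    then show "X \<in> lin_span P (ae_class P ` D)" unfolding lin_span_def by blast
  qed
qed

section \<open>The integrand\<close>

text \<open>Convexity in the weak form of quasi-convexity. Replacing both endpoint values by the
  common nonnegative bound \<open>m\<close> before combining them leaves a multiple of one extended
  real, so infinite values cause no trouble.\<close>

lemma pos_phi_between:
  assumes \<Phi>: "convex_on_halfline \<Phi>" and xyz: "0 \<le> x" "x \<le> z" "z \<le> y"
  shows "pos_phi \<Phi> z \<le> max (pos_phi \<Phi> x) (pos_phi \<Phi> y)"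
proof (cases "z = x \<or> z = y")
  case False
  define t where "t = (z - x) / (y - x)"
  have t: "0 < t" "t < 1" using False xyz by (auto simp: t_def field_simps)
  have z: "z = (1 - t) * x + t * y"
    using False xyz by (auto simp: t_def divide_simps) (simp add: algebra_simps)
  define m where "m = max (pos_phi \<Phi> x) (pos_phi \<Phi> y)"
  have m: "0 \<le> m" "\<Phi> x \<le> m" "\<Phi> y \<le> m" by (auto simp: m_def pos_phi_def le_max_iff_disj)
  have "\<Phi> z \<le> ereal (1 - t) * \<Phi> x + ereal t * \<Phi> y"
    using \<Phi> t xyz unfolding z convex_on_halfline_def by simp
  also have "\<dots> \<le> ereal (1 - t) * m + ereal t * m"
    using t m by (intro add_mono ereal_mult_left_mono) auto
  also have "\<dots> = (ereal (1 - t) + ereal t) * m"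
    using t by (intro ereal_left_distrib[symmetric]) auto
  also have "\<dots> = m" by (simp add: one_ereal_def[symmetric])
  finally show ?thesis using m(1) unfolding m_def[symmetric] by (simp add: pos_phi_def)
qed auto

definition phi_plus :: "(real \<Rightarrow> ereal) \<Rightarrow> real \<Rightarrow> ennreal" where
  "phi_plus \<Phi> y = e2ennreal (pos_phi \<Phi> y)"

lemma pos_phi_ereal: "\<Phi> y = ereal r \<Longrightarrow> pos_phi \<Phi> y = ereal (max r 0)"
  by (cases "r \<le> 0") (simp_all add: pos_phi_def max_def)

text \<open>The sum replaces the maximum so that integrals can be split by additivity.\<close>

lemma phi_plus_between:
  assumes "convex_on_halfline \<Phi>" "0 \<le> x" "x \<le> z" "z \<le> y"
  shows "phi_plus \<Phi> z \<le> phi_plus \<Phi> x + phi_plus \<Phi> y"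
proof -
  have "phi_plus \<Phi> z \<le> e2ennreal (max (pos_phi \<Phi> x) (pos_phi \<Phi> y))"
    unfolding phi_plus_def by (intro e2ennreal_mono pos_phi_between assms)
  also have "\<dots> \<le> phi_plus \<Phi> x + phi_plus \<Phi> y"
    by (auto simp: max_def phi_plus_def add_increasing add_increasing2)
  finally show ?thesis .
qed

lemma phi_plus_finite:
  assumes "\<forall>y>0. \<Phi> y \<noteq> \<infinity>" "0 < y"
  shows "phi_plus \<Phi> y < \<infinity>"
proof (cases "\<Phi> y")
  case (real r)
  then show ?thesis by (simp add: phi_plus_def pos_phi_ereal del: ereal_max)
qed (use assms in \<open>auto simp: phi_plus_def pos_phi_def e2ennreal_neg max_def\<close>)

lemma phi_plus_growth:
  assumes "growth_condition \<Phi>" "\<forall>y>0. \<Phi> y \<noteq> \<infinity>" "0 < c"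
  obtains A B :: real where "0 \<le> A" "0 \<le> B"
    "\<And>y. 0 \<le> y \<Longrightarrow> phi_plus \<Phi> (c * y) \<le> ennreal A * phi_plus \<Phi> y + ennreal (B * (y + 1))"
proof -
  obtain \<alpha> \<beta> :: real where \<alpha>: "0 < \<alpha>" and \<beta>: "0 < \<beta>" and
    le: "\<And>y. 0 < y \<Longrightarrow> pos_phi \<Phi> (c * y) \<le> ereal \<alpha> * pos_phi \<Phi> y + ereal (\<beta> * (y + 1))"
  proof -
    \<comment> \<open>The interval of factors is taken to be the single point
      \<open>c\<close>.\<close>
    have "\<exists>\<alpha> \<beta> :: real. \<alpha> > 0 \<and> \<beta> > 0 \<and> (\<forall>y>0. \<forall>l\<in>{c..c}.
        pos_phi \<Phi> (l * y) \<le> ereal \<alpha> * pos_phi \<Phi> y + ereal (\<beta> * (y + 1)))"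
      using assms(1,3) unfolding growth_condition_def by blast
    then show ?thesis using that by auto
  qed
  show ?thesis
  proof (rule that)
    fix y :: real assume y: "0 \<le> y"
    \<comment> \<open>The growth condition speaks of \<open>y > 0\<close>. At \<open>y = 0\<close>
      both sides contain \<open>phi_plus \<Phi> 0\<close>, possibly infinite, and the bound holds
      because the coefficient \<open>\<alpha> + 1\<close> is at least 1.\<close>
    show "phi_plus \<Phi> (c * y) \<le> ennreal (\<alpha> + 1) * phi_plus \<Phi> y + ennreal (\<beta> * (y + 1))"
    proof (cases "y = 0")
      case True
      have "1 * phi_plus \<Phi> 0 \<le> ennreal (\<alpha> + 1) * phi_plus \<Phi> 0"
        using \<alpha> by (intro mult_right_mono) (auto simp: ennreal_1[symmetric] simp del: ennreal_1 intro!: ennreal_leI)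
      with True show ?thesis by (simp add: add_increasing2)
    next
      case False
      with y have y: "0 < y" by simp
      have "0 \<le> pos_phi \<Phi> y" "pos_phi \<Phi> y \<noteq> \<infinity>"
        using assms(2) y by (auto simp: pos_phi_def max_def)
      then obtain r where r: "pos_phi \<Phi> y = ereal r" "0 \<le> r"
        by (cases "pos_phi \<Phi> y") auto
      have "pos_phi \<Phi> (c * y) \<le> ereal (\<alpha> * r + \<beta> * (y + 1))"
        using le[OF y] r by simp
      then have "phi_plus \<Phi> (c * y) \<le> ennreal (\<alpha> * r + \<beta> * (y + 1))"
        unfolding phi_plus_def by (rule order_trans[OF e2ennreal_mono]) simp
      also have "\<dots> \<le> ennreal ((\<alpha> + 1) * r + \<beta> * (y + 1))"
        using r by (intro ennreal_leI) (simp add: algebra_simps)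
      also have "\<dots> = ennreal (\<alpha> + 1) * phi_plus \<Phi> y + ennreal (\<beta> * (y + 1))"
        using \<alpha> \<beta> y r by (simp add: phi_plus_def ennreal_plus ennreal_mult)
      finally show ?thesis .
    qed
  qed (use \<alpha> \<beta> in auto)
qed

text \<open>A finite convex function is continuous on the open half-line. At 0 the function may jump
  or be infinite, so this point receives its own constant.\<close>

lemma phi_plus_measurable:
  assumes \<Phi>: "convex_on_halfline \<Phi>" and fin: "\<forall>y>0. \<Phi> y \<noteq> \<infinity>" "\<forall>y\<ge>0. \<Phi> y \<noteq> -\<infinity>"
    and f[measurable]: "f \<in> borel_measurable M" and f0: "\<And>\<omega>. 0 \<le> f \<omega>"
  shows "(\<lambda>\<omega>. phi_plus \<Phi> (f \<omega>)) \<in> borel_measurable M"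
proof -
  define r where "r y = real_of_ereal (\<Phi> y)" for y
  have r: "\<Phi> y = ereal (r y)" if "0 < y" for y
    unfolding r_def using fin that by (cases "\<Phi> y") (auto dest: less_imp_le)
  have "convex_on {0<..} r"
  proof (rule convex_onI)
    fix t x y :: real assume t: "0 < t" "t < 1" and xy: "x \<in> {0<..}" "y \<in> {0<..}"
    have pos: "0 < (1 - t) * x + t * y" using t xy by (simp add: add_pos_pos)
    have "\<Phi> ((1 - t) * x + t * y) \<le> ereal (1 - t) * \<Phi> x + ereal t * \<Phi> y"
      using \<Phi> t xy unfolding convex_on_halfline_def by simp
    then have "ereal (r ((1 - t) * x + t * y)) \<le> ereal ((1 - t) * r x + t * r y)"
      using r[OF pos] r[of x] r[of y] xy by simp
    then show "r ((1 - t) *\<^sub>R x + t *\<^sub>R y) \<le> (1 - t) * r x + t * r y" by simp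
  qed simp
  then have "continuous_on {0<..} r"
    by (intro convex_on_continuous) auto
  then have "(\<lambda>y. indicator {0<..} y *\<^sub>R r y) \<in> borel_measurable borel"
    by (intro borel_measurable_continuous_on_indicator) auto
  then have [measurable]: "(\<lambda>\<omega>. indicator {0<..} (f \<omega>) *\<^sub>R r (f \<omega>)) \<in> borel_measurable M"
    by (rule measurable_compose[OF f])
  have "phi_plus \<Phi> (f \<omega>) =
      (if 0 < f \<omega> then ennreal (indicator {0<..} (f \<omega>) *\<^sub>R r (f \<omega>)) else phi_plus \<Phi> 0)" for \<omega>
  proof (cases "0 < f \<omega>")
    case True
    then show ?thesis
      by (cases "r (f \<omega>) \<le> 0") (simp_all add: phi_plus_def pos_phi_ereal[OF r] max_def ennreal_neg)
  next
    case False
    with f0[of \<omega>] have "f \<omega> = 0" by simp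
    then show ?thesis by simp
  qed
  then show ?thesis by (simp cong: measurable_cong)
qed

section \<open>Densities of the pricing measures\<close>

text \<open>The members are functions that are nonnegative at every point, not classes: convex
  combinations are then pointwise, and \<open>ennreal (f \<omega>)\<close> can serve directly as the
  density of a measure.\<close>

definition densities :: "'a measure \<Rightarrow> 'a rv_class set \<Rightarrow> ('a \<Rightarrow> real) set" where
  "densities P K = {f \<in> borel_measurable P. (\<forall>\<omega>. 0 \<le> f \<omega>) \<and> integrable P f \<and> (LINT \<omega>|P. f \<omega>) = 1 \<and>
     (\<forall>X\<in>K. integrable P (\<lambda>\<omega>. rep X \<omega> * f \<omega>) \<and> (LINT \<omega>|P. rep X \<omega> * f \<omega>) \<le> 0)}"

lemma integrable_rep_density:
  assumes "rep X \<in> borel_measurable P" "f \<in> borel_measurable P" "\<And>\<omega>. 0 \<le> f \<omega>"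
  shows "integrable (density P (\<lambda>\<omega>. ennreal (f \<omega>))) (rep X) \<longleftrightarrow> integrable P (\<lambda>\<omega>. rep X \<omega> * f \<omega>)"
  using integrable_density[of "rep X" P f] assms by (simp add: mult.commute)

lemma expect_density:
  assumes "rep X \<in> borel_measurable P" "f \<in> borel_measurable P" "\<And>\<omega>. 0 \<le> f \<omega>"
  shows "expect (density P (\<lambda>\<omega>. ennreal (f \<omega>))) X = (LINT \<omega>|P. rep X \<omega> * f \<omega>)"
  using integral_density[of "rep X" P f] assms by (simp add: mult.commute expect_def)

context prob_space
begin

lemma density_dens:
  assumes "sigma_finite_measure Q" "sets Q = sets M" "absolutely_continuous M Q"
  shows "density M (\<lambda>\<omega>. ennreal (dens M Q \<omega>)) = Q"
proof -
  have "AE \<omega> in M. ennreal (dens M Q \<omega>) = RN_deriv M Q \<omega>"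
    using RN_deriv_finite[OF assms(1,3,2)] by eventually_elim (simp add: dens_def less_top)
  then have "density M (\<lambda>\<omega>. ennreal (dens M Q \<omega>)) = density M (RN_deriv M Q)"
    by (intro density_cong) (simp_all add: dens_def)
  also have "\<dots> = Q" by (rule density_RN_deriv) fact+
  finally show ?thesis .
qed

lemma dens_measurable[measurable]: "dens M Q \<in> borel_measurable M"
  unfolding dens_def[abs_def] by measurable

lemma dens_nonneg: "0 \<le> dens M Q \<omega>"
  by (simp add: dens_def)

lemma dens_density:
  assumes [measurable]: "f \<in> borel_measurable M" and f0: "\<And>\<omega>. 0 \<le> f \<omega>"
  shows "AE \<omega> in M. dens M (density M (\<lambda>\<omega>. ennreal (f \<omega>))) \<omega> = f \<omega>"
proof -
  have "AE \<omega> in M. ennreal (f \<omega>) = RN_deriv M (density M (\<lambda>\<omega>. ennreal (f \<omega>))) \<omega>"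
    by (rule RN_deriv_unique) auto
  then show ?thesis
    by eventually_elim (metis dens_def enn2real_ennreal f0)
qed

lemma M1_dens:
  assumes K: "K \<subseteq> L0 M" and Q: "Q \<in> M1 M K"
  shows "dens M Q \<in> densities M K"
proof -
  interpret Q: prob_space Q using Q by (simp add: M1_def)
  have eq: "density M (\<lambda>\<omega>. ennreal (dens M Q \<omega>)) = Q"
    using Q by (intro density_dens) (auto simp: M1_def Q.sigma_finite_measure_axioms)
  have rep: "rep X \<in> borel_measurable M" if "X \<in> K" for X
    using K that by (intro rep_measurable) auto
  have "integrable (density M (\<lambda>\<omega>. ennreal (dens M Q \<omega>))) (\<lambda>\<omega>. 1 :: real)"
    unfolding eq by simp
  then have int: "integrable M (dens M Q)"
    by (subst (asm) integrable_density) (auto simp: dens_nonneg)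
  have "1 = (LINT \<omega>|Q. 1 :: real)" by (simp add: Q.prob_space)
  also have "\<dots> = (LINT \<omega>|density M (\<lambda>\<omega>. ennreal (dens M Q \<omega>)). 1 :: real)" by (simp only: eq)
  also have "\<dots> = (LINT \<omega>|M. dens M Q \<omega>)"
    by (subst integral_density) (auto simp: dens_nonneg)
  finally have "(LINT \<omega>|M. dens M Q \<omega>) = 1" by simp
  moreover have "integrable M (\<lambda>\<omega>. rep X \<omega> * dens M Q \<omega>) \<and> (LINT \<omega>|M. rep X \<omega> * dens M Q \<omega>) \<le> 0"
    if X: "X \<in> K" for X
  proof -
    have "integrable Q (rep X)" "expect Q X \<le> 0"
      using X Q unfolding M1_def L1_def by auto
    then show ?thesis
      using integrable_rep_density[OF rep[OF X] dens_measurable dens_nonneg, of Q]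
        expect_density[OF rep[OF X] dens_measurable dens_nonneg, of Q]
      by (simp add: eq)
  qed
  ultimately show ?thesis using int by (simp add: densities_def dens_nonneg)
qed

lemma density_M1:
  assumes K: "K \<subseteq> L0 M" and f: "f \<in> densities M K"
  shows "density M (\<lambda>\<omega>. ennreal (f \<omega>)) \<in> M1 M K" (is "?Q \<in> _")
proof -
  have [measurable]: "f \<in> borel_measurable M" and f0: "\<And>\<omega>. 0 \<le> f \<omega>" and int: "integrable M f"
    and one: "(LINT \<omega>|M. f \<omega>) = 1"
    using f by (auto simp: densities_def)
  have rep: "rep X \<in> borel_measurable M" if "X \<in> K" for X
    using K that by (intro rep_measurable) auto
  have "emeasure ?Q (space ?Q) = (\<integral>\<^sup>+ \<omega>. ennreal (f \<omega>) \<partial>M)"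
    by (subst emeasure_density) (auto intro!: nn_integral_cong)
  also have "\<dots> = 1"
    by (subst nn_integral_eq_integral) (auto simp: f0 int one)
  finally have "prob_space ?Q" by (rule prob_spaceI)
  moreover have "absolutely_continuous M ?Q" by (rule absolutely_continuousI_density) simp
  moreover have "X \<in> L1 M ?Q \<and> expect ?Q X \<le> 0" if X: "X \<in> K" for X
    using f X K integrable_rep_density[OF rep[OF X] _ f0] expect_density[OF rep[OF X] _ f0]
    by (auto simp: L1_def densities_def)
  ultimately show ?thesis unfolding M1_def by auto
qed

lemma R_density: 
  assumes "f \<in> densities M K"
  shows "R M (density M (\<lambda>\<omega>. ennreal (f \<omega>))) = ae_class M f"
  unfolding R_def using assms by (intro ae_class_eqI dens_density) (auto simp: densities_def)

text \<open>Normalisation is how pricing measures are obtained both from nonnegative elements of the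
  span and from separating functionals.\<close>

lemma densities_scaled:
  assumes f[measurable]: "f \<in> borel_measurable M" and f0: "\<And>\<omega>. 0 \<le> f \<omega>" and int: "integrable M f"
    and pos: "0 < (LINT \<omega>|M. f \<omega>)"
    and K: "\<And>X. X \<in> K \<Longrightarrow> integrable M (\<lambda>\<omega>. rep X \<omega> * f \<omega>)"
    "\<And>X. X \<in> K \<Longrightarrow> (LINT \<omega>|M. rep X \<omega> * f \<omega>) \<le> 0"
  shows "(\<lambda>\<omega>. f \<omega> / (LINT \<omega>|M. f \<omega>)) \<in> densities M K"
  using assms by (auto simp: densities_def divide_nonpos_pos)

lemma convex_densities: "convex (densities M K)"
proof (rule convex_funI)
  fix f g u v assume fg: "f \<in> densities M K" "g \<in> densities M K" and uv: "0 \<le> u" "0 \<le> v" "u + v = (1::real)"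
  have "integrable M (\<lambda>\<omega>. rep X \<omega> * (u * f \<omega> + v * g \<omega>)) \<and>
      (LINT \<omega>|M. rep X \<omega> * (u * f \<omega> + v * g \<omega>)) \<le> 0" if X: "X \<in> K" for X
  proof -
    have eq: "rep X \<omega> * (u * f \<omega> + v * g \<omega>) = u * (rep X \<omega> * f \<omega>) + v * (rep X \<omega> * g \<omega>)" for \<omega>
      by (simp add: algebra_simps)
    show ?thesis
      unfolding eq using fg X uv by (auto simp: densities_def add_nonpos_nonpos mult_nonneg_nonpos)
  qed
  with fg uv show "(\<lambda>\<omega>. u * f \<omega> + v * g \<omega>) \<in> densities M K"
    by (auto simp: densities_def)
qed

end

section \<open>The dual pair\<close>

locale dual_setting = prob_space P for P :: "'a measure" +
  fixes K :: "'a rv_class set" and \<Phi> :: "real \<Rightarrow> ereal"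
  assumes wedge_K: "wedge P K"
    and Phi_lower: "\<forall>y\<ge>0. \<Phi> y \<noteq> -\<infinity>"
    and Phi_finite: "\<forall>y>0. \<Phi> y \<noteq> \<infinity>"
    and Phi_convex: "convex_on_halfline \<Phi>"
    and Phi_growth: "growth_condition \<Phi>"
    and M_Phi_nonempty: "M_Phi P K \<Phi> \<noteq> {}"
begin

definition D_Phi :: "('a \<Rightarrow> real) set" where
  "D_Phi = {f \<in> densities P K. (\<integral>\<^sup>+ \<omega>. phi_plus \<Phi> (f \<omega>) \<partial>P) < \<infinity>}"

definition D_hat :: "('a \<Rightarrow> real) set" where
  "D_hat = {f \<in> densities P K. (\<integral>\<^sup>+ \<omega>. phi_plus \<Phi> (f \<omega>) * indicator {\<omega>. f \<omega> \<ge> 1} \<omega> \<partial>P) < \<infinity>}"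

abbreviation "E \<equiv> E_Phi P K \<Phi>"
abbreviation "F \<equiv> F_Phi P K \<Phi>"

section \<open>Correspondence between sets of measures and sets of densities\<close>

lemma K_L0: "K \<subseteq> L0 P"
  using wedge_K by (simp add: wedge_def)

lemma densitiesD:
  assumes "f \<in> densities P K"
  shows "f \<in> borel_measurable P" "\<And>\<omega>. 0 \<le> f \<omega>" "integrable P f" "(LINT \<omega>|P. f \<omega>) = 1"
    "\<And>X. X \<in> K \<Longrightarrow> integrable P (\<lambda>\<omega>. rep X \<omega> * f \<omega>)"
    "\<And>X. X \<in> K \<Longrightarrow> (LINT \<omega>|P. rep X \<omega> * f \<omega>) \<le> 0"
  using assms by (auto simp: densities_def)

lemma D_Phi_densities: "f \<in> D_Phi \<Longrightarrow> f \<in> densities P K"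
  by (simp add: D_Phi_def)

lemma D_hat_densities: "f \<in> D_hat \<Longrightarrow> f \<in> densities P K"
  by (simp add: D_hat_def)

lemma phi_measurable:
  assumes "f \<in> densities P K"
  shows "(\<lambda>\<omega>. phi_plus \<Phi> (f \<omega>)) \<in> borel_measurable P"
  by (intro phi_plus_measurable Phi_convex Phi_finite Phi_lower densitiesD[OF assms])

lemma phi_cong_AE:
  assumes "AE \<omega> in P. f \<omega> = g \<omega>"
  shows "(\<integral>\<^sup>+ \<omega>. phi_plus \<Phi> (f \<omega>) \<partial>P) = (\<integral>\<^sup>+ \<omega>. phi_plus \<Phi> (g \<omega>) \<partial>P)"
    and "(\<integral>\<^sup>+ \<omega>. phi_plus \<Phi> (f \<omega>) * indicator {\<omega>. f \<omega> \<ge> 1} \<omega> \<partial>P) =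
      (\<integral>\<^sup>+ \<omega>. phi_plus \<Phi> (g \<omega>) * indicator {\<omega>. g \<omega> \<ge> 1} \<omega> \<partial>P)"
  using assms by (auto intro!: nn_integral_cong_AE elim!: eventually_mono simp: indicator_def)

lemma R_M1: "R P ` M1 P K = ae_class P ` densities P K"
proof (intro equalityI image_subsetI)
  fix Q assume "Q \<in> M1 P K"
  then show "R P Q \<in> ae_class P ` densities P K"
    unfolding R_def by (intro imageI M1_dens K_L0)
next
  fix f assume f: "f \<in> densities P K"
  then show "ae_class P f \<in> R P ` M1 P K"
    by (metis R_density density_M1[OF K_L0] imageI)
qed

lemma density_M_Phi:
  assumes f: "f \<in> D_Phi"
  shows "density P (\<lambda>\<omega>. ennreal (f \<omega>)) \<in> M_Phi P K \<Phi>"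
  using density_M1[OF K_L0 D_Phi_densities[OF f]] f
    phi_cong_AE(1)[OF dens_density[OF densitiesD(1,2)[OF D_Phi_densities[OF f]]]]
  by (simp add: M_Phi_def D_Phi_def phi_plus_def)

lemma dens_D_Phi:
  assumes "Q \<in> M_Phi P K \<Phi>"
  shows "dens P Q \<in> D_Phi"
  using assms M1_dens[OF K_L0, of Q] by (simp add: M_Phi_def D_Phi_def phi_plus_def)

lemma R_M_Phi: "R P ` M_Phi P K \<Phi> = ae_class P ` D_Phi"
proof (intro equalityI image_subsetI)
  fix Q assume "Q \<in> M_Phi P K \<Phi>"
  then show "R P Q \<in> ae_class P ` D_Phi"
    unfolding R_def by (intro imageI dens_D_Phi)
next
  fix f assume f: "f \<in> D_Phi"
  then show "ae_class P f \<in> R P ` M_Phi P K \<Phi>"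
    by (metis R_density density_M_Phi imageI D_Phi_densities)
qed

lemma R_M_hat_Phi: "R P ` M_hat_Phi P K \<Phi> = ae_class P ` D_hat"
proof (intro equalityI image_subsetI)
  fix Q assume "Q \<in> M_hat_Phi P K \<Phi>"
  then have "dens P Q \<in> D_hat"
    using M1_dens[OF K_L0, of Q] by (simp add: M_hat_Phi_def D_hat_def phi_plus_def)
  then show "R P Q \<in> ae_class P ` D_hat" unfolding R_def by (rule imageI)
next
  fix f assume f: "f \<in> D_hat"
  have "density P (\<lambda>\<omega>. ennreal (f \<omega>)) \<in> M_hat_Phi P K \<Phi>"
    using density_M1[OF K_L0 D_hat_densities[OF f]] f
      phi_cong_AE(2)[OF dens_density[OF densitiesD(1,2)[OF D_hat_densities[OF f]]]]
    by (simp add: M_hat_Phi_def D_hat_def phi_plus_def)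
  then show "ae_class P f \<in> R P ` M_hat_Phi P K \<Phi>"
    by (metis R_density imageI f D_hat_densities)
qed

section \<open>Convexity, mixtures and domination of densities\<close>

lemma D_Phi_nonempty: "D_Phi \<noteq> {}"
  using M_Phi_nonempty dens_D_Phi by blast

text \<open>Both bounds come from quasi-convexity on the segment. For the truncated one, a point of
  the segment that is at least 1 lies between 1 and the larger endpoint, which is then at least 1
  itself, so its indicator does not vanish.\<close>

lemma phi_segment:
  assumes fg: "0 \<le> x" "0 \<le> y" and uv: "0 \<le> u" "0 \<le> v" "u + v = (1::real)"
  shows "phi_plus \<Phi> (u * x + v * y) \<le> phi_plus \<Phi> x + phi_plus \<Phi> y"
    and "phi_plus \<Phi> (u * x + v * y) * indicator {1..} (u * x + v * y) \<le>
      phi_plus \<Phi> 1 + phi_plus \<Phi> x * indicator {1..} x + phi_plus \<Phi> y * indicator {1..} y"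
proof -
  have v: "v = 1 - u" using uv by simp
  \<comment> \<open>The order \<open>x \<le> y\<close> is assumed here; the other case follows by
    exchanging the endpoints together with their weights.\<close>
  have *: "(phi_plus \<Phi> (u * x + v * y) \<le> phi_plus \<Phi> x + phi_plus \<Phi> y) \<and>
     (phi_plus \<Phi> (u * x + v * y) * indicator {1..} (u * x + v * y) \<le>
      phi_plus \<Phi> 1 + phi_plus \<Phi> x * indicator {1..} x + phi_plus \<Phi> y * indicator {1..} y)"
    if "0 \<le> x" "x \<le> y" "0 \<le> u" "0 \<le> v" "u + v = 1" for x y u v :: real
  proof -
    have "u * x + v * x \<le> u * x + v * y" "u * x + v * y \<le> u * y + v * y"
      using that by (auto intro!: mult_left_mono add_mono)
    then have b: "x \<le> u * x + v * y" "u * x + v * y \<le> y"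
      using that(5) by (simp_all flip: distrib_right)
    have "phi_plus \<Phi> (u * x + v * y) \<le> phi_plus \<Phi> 1 + phi_plus \<Phi> y"
      if "1 \<le> u * x + v * y"
      using that b by (intro phi_plus_between[OF Phi_convex]) auto
    then have "phi_plus \<Phi> (u * x + v * y) * indicator {1..} (u * x + v * y) \<le>
        phi_plus \<Phi> 1 + phi_plus \<Phi> x * indicator {1..} x + phi_plus \<Phi> y * indicator {1..} y"
      using b by (auto simp: indicator_def intro: order_trans add_increasing2 add_mono)
    with b that show ?thesis
      by (intro conjI phi_plus_between[OF Phi_convex]) auto
  qed
  show "phi_plus \<Phi> (u * x + v * y) \<le> phi_plus \<Phi> x + phi_plus \<Phi> y"
    and "phi_plus \<Phi> (u * x + v * y) * indicator {1..} (u * x + v * y) \<le>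
      phi_plus \<Phi> 1 + phi_plus \<Phi> x * indicator {1..} x + phi_plus \<Phi> y * indicator {1..} y"
    using *[of x y u v] *[of y x v u] assms by (cases "x \<le> y"; simp add: ac_simps)+
qed

lemma indicator_ge1: "indicator {\<omega>. f \<omega> \<ge> 1} \<omega> = indicator {1::real..} (f \<omega>)"
  by (simp add: indicator_def)

text \<open>The affine term of the growth bound is harmless because \<open>f\<close> has integral 1
  and \<open>P\<close> is a probability.\<close>

lemma phi_growth_integral:
  assumes f: "f \<in> D_Phi" and c: "0 < c"
  shows "(\<integral>\<^sup>+ \<omega>. phi_plus \<Phi> (c * f \<omega>) \<partial>P) < \<infinity>"
proof -
  note fd = densitiesD[OF D_Phi_densities[OF f]]
  note [measurable] = fd(1) phi_measurable[OF D_Phi_densities[OF f]]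
  obtain A B :: real where AB: "0 \<le> A" "0 \<le> B"
    "\<And>y. 0 \<le> y \<Longrightarrow> phi_plus \<Phi> (c * y) \<le> ennreal A * phi_plus \<Phi> y + ennreal (B * (y + 1))"
    by (rule phi_plus_growth[OF Phi_growth Phi_finite c]) blast
  have "(\<integral>\<^sup>+ \<omega>. phi_plus \<Phi> (c * f \<omega>) \<partial>P) \<le>
      (\<integral>\<^sup>+ \<omega>. ennreal A * phi_plus \<Phi> (f \<omega>) + ennreal (B * (f \<omega> + 1)) \<partial>P)"
    by (intro nn_integral_mono AB(3) fd(2))
  also have "\<dots> = ennreal A * (\<integral>\<^sup>+ \<omega>. phi_plus \<Phi> (f \<omega>) \<partial>P) + (\<integral>\<^sup>+ \<omega>. ennreal (B * (f \<omega> + 1)) \<partial>P)"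
    by (simp add: nn_integral_add nn_integral_cmult)
  also have "(\<integral>\<^sup>+ \<omega>. ennreal (B * (f \<omega> + 1)) \<partial>P) = ennreal (LINT \<omega>|P. B * (f \<omega> + 1))"
    using fd AB(2) by (intro nn_integral_eq_integral) auto
  also have "ennreal A * (\<integral>\<^sup>+ \<omega>. phi_plus \<Phi> (f \<omega>) \<partial>P) + \<dots> < \<infinity>"
    using f by (simp add: D_Phi_def ennreal_mult_less_top)
  finally show ?thesis .
qed

lemma phi_scale_measurable:
  assumes f: "f \<in> densities P K" and c: "0 < c"
  shows "(\<lambda>\<omega>. phi_plus \<Phi> (c * f \<omega>)) \<in> borel_measurable P"
  using densitiesD[OF f] c by (intro phi_plus_measurable Phi_convex Phi_finite Phi_lower) auto

lemma convex_D_Phi: "convex D_Phi"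
proof (rule convex_funI)
  fix f g u v assume f: "f \<in> D_Phi" and g: "g \<in> D_Phi" and uv: "0 \<le> u" "0 \<le> v" "u + v = (1::real)"
  note fd = densitiesD[OF D_Phi_densities[OF f]] and gd = densitiesD[OF D_Phi_densities[OF g]]
  note [measurable] = phi_measurable[OF D_Phi_densities[OF f]] phi_measurable[OF D_Phi_densities[OF g]]
  have "(\<integral>\<^sup>+ \<omega>. phi_plus \<Phi> (u * f \<omega> + v * g \<omega>) \<partial>P) \<le>
      (\<integral>\<^sup>+ \<omega>. phi_plus \<Phi> (f \<omega>) + phi_plus \<Phi> (g \<omega>) \<partial>P)"
    by (intro nn_integral_mono phi_segment fd gd uv)
  also have "\<dots> = (\<integral>\<^sup>+ \<omega>. phi_plus \<Phi> (f \<omega>) \<partial>P) + (\<integral>\<^sup>+ \<omega>. phi_plus \<Phi> (g \<omega>) \<partial>P)"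
    by (rule nn_integral_add) measurable
  also have "\<dots> < \<infinity>" using f g by (simp add: D_Phi_def)
  finally show "(\<lambda>\<omega>. u * f \<omega> + v * g \<omega>) \<in> D_Phi"
    unfolding D_Phi_def
    using convex_funD[OF convex_densities D_Phi_densities[OF f] D_Phi_densities[OF g] uv] by simp
qed

lemma convex_D_hat: "convex D_hat"
proof (rule convex_funI)
  fix f g u v assume f: "f \<in> D_hat" and g: "g \<in> D_hat" and uv: "0 \<le> u" "0 \<le> v" "u + v = (1::real)"
  note fd = densitiesD[OF D_hat_densities[OF f]] and gd = densitiesD[OF D_hat_densities[OF g]]
  note [measurable] = fd(1) gd(1) phi_measurable[OF D_hat_densities[OF f]] phi_measurable[OF D_hat_densities[OF g]]
  let ?I = "\<lambda>f. \<integral>\<^sup>+ \<omega>. phi_plus \<Phi> (f \<omega>) * indicator {1::real..} (f \<omega>) \<partial>P"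
  have "?I (\<lambda>\<omega>. u * f \<omega> + v * g \<omega>) \<le> (\<integral>\<^sup>+ \<omega>. phi_plus \<Phi> 1 +
      phi_plus \<Phi> (f \<omega>) * indicator {1..} (f \<omega>) + phi_plus \<Phi> (g \<omega>) * indicator {1..} (g \<omega>) \<partial>P)"
    by (intro nn_integral_mono phi_segment fd gd uv)
  also have "\<dots> = phi_plus \<Phi> 1 + ?I f + ?I g"
    by (simp add: nn_integral_add emeasure_space_1)
  also have "\<dots> < \<infinity>"
    using f g phi_plus_finite[OF Phi_finite, of 1] by (simp add: D_hat_def indicator_ge1)
  finally show "(\<lambda>\<omega>. u * f \<omega> + v * g \<omega>) \<in> D_hat"
    unfolding D_hat_def indicator_ge1
    using convex_funD[OF convex_densities D_hat_densities[OF f] D_hat_densities[OF g] uv] by simp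
qed

lemma D_Phi_subset_D_hat: "D_Phi \<subseteq> D_hat"
proof
  fix f assume f: "f \<in> D_Phi"
  have "(\<integral>\<^sup>+ \<omega>. phi_plus \<Phi> (f \<omega>) * indicator {\<omega>. f \<omega> \<ge> 1} \<omega> \<partial>P) \<le> (\<integral>\<^sup>+ \<omega>. phi_plus \<Phi> (f \<omega>) \<partial>P)"
    by (intro nn_integral_mono) (simp add: indicator_def)
  with f show "f \<in> D_hat"
    by (auto simp: D_Phi_def D_hat_def intro: le_less_trans)
qed

text \<open>On the set where the mixture is at least 1 its integrand is controlled by the truncated
  integrals; where it is below 1 it lies between \<open>v * g\<close> and 1, and the growth condition applies.\<close>

lemma D_hat_mixture:
  assumes f: "f \<in> D_hat" and g: "g \<in> D_Phi" and uv: "0 \<le> u" "0 < v" "u + v = (1::real)"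
  shows "(\<lambda>\<omega>. u * f \<omega> + v * g \<omega>) \<in> D_Phi"
proof -
  note fd = densitiesD[OF D_hat_densities[OF f]] and gd = densitiesD[OF D_Phi_densities[OF g]]
  have g': "g \<in> D_hat" using g D_Phi_subset_D_hat by blast
  note [measurable] = fd(1) gd(1) phi_measurable[OF D_hat_densities[OF f]]
    phi_measurable[OF D_hat_densities[OF g']] phi_scale_measurable[OF D_Phi_densities[OF g] uv(2)]
  let ?I = "\<lambda>f. \<integral>\<^sup>+ \<omega>. phi_plus \<Phi> (f \<omega>) * indicator {1::real..} (f \<omega>) \<partial>P"
  have "phi_plus \<Phi> (u * f \<omega> + v * g \<omega>) \<le> phi_plus \<Phi> 1 + phi_plus \<Phi> (f \<omega>) * indicator {1..} (f \<omega>)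
      + phi_plus \<Phi> (g \<omega>) * indicator {1..} (g \<omega>) + phi_plus \<Phi> (v * g \<omega>)" for \<omega>
  proof (cases "1 \<le> u * f \<omega> + v * g \<omega>")
    case True
    then show ?thesis
      using phi_segment(2)[OF fd(2) gd(2) uv(1) less_imp_le[OF uv(2)] uv(3), of \<omega> \<omega>]
      by (simp add: add_increasing2)
  next
    case False
    have "phi_plus \<Phi> (u * f \<omega> + v * g \<omega>) \<le> phi_plus \<Phi> (v * g \<omega>) + phi_plus \<Phi> 1"
      using False fd(2)[of \<omega>] gd(2)[of \<omega>] uv by (intro phi_plus_between[OF Phi_convex]) auto
    also have "\<dots> \<le> phi_plus \<Phi> (v * g \<omega>) + phi_plus \<Phi> 1 + (phi_plus \<Phi> (f \<omega>) * indicator {1..} (f \<omega>)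
      + phi_plus \<Phi> (g \<omega>) * indicator {1..} (g \<omega>))" by simp
    finally show ?thesis by (simp add: ac_simps)
  qed
  then have "(\<integral>\<^sup>+ \<omega>. phi_plus \<Phi> (u * f \<omega> + v * g \<omega>) \<partial>P) \<le> (\<integral>\<^sup>+ \<omega>. phi_plus \<Phi> 1 +
      phi_plus \<Phi> (f \<omega>) * indicator {1..} (f \<omega>) + phi_plus \<Phi> (g \<omega>) * indicator {1..} (g \<omega>) +
      phi_plus \<Phi> (v * g \<omega>) \<partial>P)"
    by (rule nn_integral_mono)
  also have "\<dots> = phi_plus \<Phi> 1 + ?I f + ?I g + (\<integral>\<^sup>+ \<omega>. phi_plus \<Phi> (v * g \<omega>) \<partial>P)"
    by (simp add: nn_integral_add emeasure_space_1)
  also have "\<dots> < \<infinity>"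
    using f g' phi_plus_finite[OF Phi_finite, of 1] phi_growth_integral[OF g uv(2)]
    by (simp add: D_hat_def indicator_ge1)
  finally show ?thesis
    unfolding D_Phi_def
    using convex_funD[OF convex_densities D_hat_densities[OF f] D_Phi_densities[OF g] uv(1) less_imp_le[OF uv(2)] uv(3)]
    by simp
qed

text \<open>Where \<open>f\<close> is at least 1 it lies between 1 and \<open>c * g\<close>, and
  quasi-convexity applies. Where \<open>f\<close> is below 1 the domination provides no lower
  endpoint, so only the truncated integral is controlled.\<close>

lemma D_hat_dominated:
  assumes f: "f \<in> densities P K" and g: "g \<in> D_Phi" and c: "0 < c"
    and le: "AE \<omega> in P. f \<omega> \<le> c * g \<omega>"
  shows "f \<in> D_hat"
proof -
  note fd = densitiesD[OF f] and gd = densitiesD[OF D_Phi_densities[OF g]]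
  note [measurable] = phi_scale_measurable[OF D_Phi_densities[OF g] c]
  have "(\<integral>\<^sup>+ \<omega>. phi_plus \<Phi> (f \<omega>) * indicator {\<omega>. f \<omega> \<ge> 1} \<omega> \<partial>P) \<le>
      (\<integral>\<^sup>+ \<omega>. phi_plus \<Phi> 1 + phi_plus \<Phi> (c * g \<omega>) \<partial>P)"
  proof (rule nn_integral_mono_AE, use le in eventually_elim)
    case (elim \<omega>)
    then show ?case
      by (cases "1 \<le> f \<omega>") (auto intro!: phi_plus_between[OF Phi_convex])
  qed
  also have "\<dots> = phi_plus \<Phi> 1 + (\<integral>\<^sup>+ \<omega>. phi_plus \<Phi> (c * g \<omega>) \<partial>P)"
    by (simp add: nn_integral_add emeasure_space_1)
  also have "\<dots> < \<infinity>"
    using phi_plus_finite[OF Phi_finite, of 1] phi_growth_integral[OF g c] by simp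
  finally show ?thesis using f by (simp add: D_hat_def)
qed

section \<open>The space E and its lattice structure\<close>

lemma E_iff: "X \<in> E \<longleftrightarrow> X \<in> L0 P \<and> (\<forall>f\<in>D_Phi. integrable P (\<lambda>\<omega>. rep X \<omega> * f \<omega>))"
proof
  assume X: "X \<in> E"
  \<comment> \<open>One measure is required to place \<open>X\<close> in \<open>L0 P\<close>: an
    intersection over an empty family would contain every set.\<close>
  obtain Q where "Q \<in> M_Phi P K \<Phi>" using M_Phi_nonempty by blast
  with X have L0: "X \<in> L0 P" by (auto simp: E_Phi_def L1_def)
  moreover have "integrable P (\<lambda>\<omega>. rep X \<omega> * f \<omega>)" if f: "f \<in> D_Phi" for f
  proof -
    have "integrable (density P (\<lambda>\<omega>. ennreal (f \<omega>))) (rep X)"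
      using X density_M_Phi[OF f] by (auto simp: E_Phi_def L1_def)
    then show ?thesis
      using integrable_rep_density[OF rep_measurable[OF L0] densitiesD(1,2)[OF D_Phi_densities[OF f]]] by simp
  qed
  ultimately show "X \<in> L0 P \<and> (\<forall>f\<in>D_Phi. integrable P (\<lambda>\<omega>. rep X \<omega> * f \<omega>))" by blast
next
  assume X: "X \<in> L0 P \<and> (\<forall>f\<in>D_Phi. integrable P (\<lambda>\<omega>. rep X \<omega> * f \<omega>))"
  have "integrable Q (rep X)" if Q: "Q \<in> M_Phi P K \<Phi>" for Q
  proof -
    have "prob_space Q" "sets Q = sets P" "absolutely_continuous P Q"
      using Q by (auto simp: M_Phi_def M1_def)
    then have "density P (\<lambda>\<omega>. ennreal (dens P Q \<omega>)) = Q"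
      by (intro density_dens prob_space_imp_sigma_finite)
    then show ?thesis
      using X dens_D_Phi[OF Q] integrable_rep_density[OF _ dens_measurable dens_nonneg, of X Q]
      by (simp add: rep_measurable)
  qed
  with X show "X \<in> E" by (auto simp: E_Phi_def L1_def)
qed

lemma K_subset_E: "K \<subseteq> E"
  using K_L0 densitiesD(5) D_Phi_densities by (auto simp: E_iff)

text \<open>A bound by two elements at once covers differences and truncated differences of elements
  of \<open>E\<close>, and, by taking the constant 1 twice, bounded functions.\<close>

lemma E_dominated:
  assumes X: "X \<in> E" and Y: "Y \<in> E" and h[measurable]: "h \<in> borel_measurable P"
    and le: "AE \<omega> in P. \<bar>h \<omega>\<bar> \<le> \<bar>rep X \<omega>\<bar> + \<bar>rep Y \<omega>\<bar>"
  shows "ae_class P h \<in> E"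
  unfolding E_iff
proof (intro conjI ballI)
  show "ae_class P h \<in> L0 P" by (rule ae_class_in_L0[OF h])
  then have [measurable]: "rep (ae_class P h) \<in> borel_measurable P" by (rule rep_measurable)
  fix f assume f: "f \<in> D_Phi"
  note fd = densitiesD[OF D_Phi_densities[OF f]]
  note [measurable] = fd(1)
  have "integrable P (\<lambda>\<omega>. \<bar>rep X \<omega> * f \<omega>\<bar> + \<bar>rep Y \<omega> * f \<omega>\<bar>)"
    using X Y f by (auto simp: E_iff)
  then show "integrable P (\<lambda>\<omega>. rep (ae_class P h) \<omega> * f \<omega>)"
  proof (rule Bochner_Integration.integrable_bound)
    show "AE \<omega> in P. norm (rep (ae_class P h) \<omega> * f \<omega>) \<le> norm (\<bar>rep X \<omega> * f \<omega>\<bar> + \<bar>rep Y \<omega> * f \<omega>\<bar>)"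
      using le rep_ae_class[OF h]
    proof eventually_elim
      case (elim \<omega>)
      then have "\<bar>h \<omega>\<bar> * f \<omega> \<le> (\<bar>rep X \<omega>\<bar> + \<bar>rep Y \<omega>\<bar>) * f \<omega>"
        by (intro mult_right_mono fd)
      with elim show ?case by (simp add: abs_mult fd(2) distrib_right)
    qed
  qed measurable
qed

lemma bounded_E:
  assumes h[measurable]: "h \<in> borel_measurable P" and le: "\<And>\<omega>. \<bar>h \<omega>\<bar> \<le> 1"
  shows "ae_class P h \<in> E"
proof -
  have one: "ae_class P (\<lambda>\<omega>. 1) \<in> E"
    unfolding E_iff
  proof (intro conjI ballI ae_class_in_L0)
    fix f assume f: "f \<in> D_Phi"
    note fd = densitiesD[OF D_Phi_densities[OF f]]
    have "AE \<omega> in P. f \<omega> = rep (ae_class P (\<lambda>\<omega>. 1)) \<omega> * f \<omega>"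
      using rep_ae_class[of "\<lambda>\<omega>. 1" P] by (auto elim!: eventually_mono)
    moreover have "rep (ae_class P (\<lambda>\<omega>. 1)) \<in> borel_measurable P"
      by (intro rep_measurable ae_class_in_L0) simp
    ultimately show "integrable P (\<lambda>\<omega>. rep (ae_class P (\<lambda>\<omega>. 1)) \<omega> * f \<omega>)"
      using fd by (intro integrable_cong_AE_imp[OF fd(3)]) auto
  qed simp
  have "\<bar>h \<omega>\<bar> \<le> 2" for \<omega> using le[of \<omega>] by simp
  then have "AE \<omega> in P. \<bar>h \<omega>\<bar> \<le> \<bar>rep (ae_class P (\<lambda>\<omega>. 1)) \<omega>\<bar> + \<bar>rep (ae_class P (\<lambda>\<omega>. 1)) \<omega>\<bar>"
    using rep_ae_class[of "\<lambda>\<omega>. 1" P] by (auto elim!: eventually_mono)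
  with one show ?thesis by (intro E_dominated[OF one one]) auto
qed

section \<open>The span F and its pairing with E\<close>

lemma F_eq: "F = {ae_class P (\<lambda>\<omega>. a * f \<omega> - b * g \<omega>) | a b f g. 0 \<le> a \<and> 0 \<le> b \<and> f \<in> D_Phi \<and> g \<in> D_Phi}"
  unfolding F_Phi_def R_M_Phi
  by (rule lin_span_ae_class[OF convex_D_Phi D_Phi_nonempty]) (auto dest: D_Phi_densities densitiesD)

lemma F_I: "0 \<le> a \<Longrightarrow> 0 \<le> b \<Longrightarrow> f \<in> D_Phi \<Longrightarrow> g \<in> D_Phi \<Longrightarrow> ae_class P (\<lambda>\<omega>. a * f \<omega> - b * g \<omega>) \<in> F"
  unfolding F_eq by blast

lemma F_L0: "w \<in> F \<Longrightarrow> w \<in> L0 P"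
proof -
  assume "w \<in> F"
  then obtain a b f g where fg: "f \<in> D_Phi" "g \<in> D_Phi" and w: "w = ae_class P (\<lambda>\<omega>. a * f \<omega> - b * g \<omega>)"
    unfolding F_eq by blast
  have [measurable]: "f \<in> borel_measurable P" "g \<in> borel_measurable P"
    using fg by (auto dest!: D_Phi_densities intro: densitiesD(1))
  show ?thesis unfolding w by (rule ae_class_in_L0) measurable
qed

lemma F_dominated:
  assumes "w \<in> F"
  obtains c f where "0 < c" "f \<in> D_Phi" "AE \<omega> in P. \<bar>rep w \<omega>\<bar> \<le> c * f \<omega>"
proof -
  obtain a b f g where w: "0 \<le> a" "0 \<le> b" "f \<in> D_Phi" "g \<in> D_Phi" "w = ae_class P (\<lambda>\<omega>. a * f \<omega> - b * g \<omega>)"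
    using assms unfolding F_eq by blast
  note fd = densitiesD[OF D_Phi_densities[OF w(3)]] and gd = densitiesD[OF D_Phi_densities[OF w(4)]]
  note [measurable] = fd(1) gd(1)
  obtain h where h: "h \<in> D_Phi" "\<And>\<omega>. a * f \<omega> + b * g \<omega> = (a + b) * h \<omega>"
    by (rule convex_fun_cone[OF convex_D_Phi w(3,4,1,2)]) blast
  have "AE \<omega> in P. rep w \<omega> = a * f \<omega> - b * g \<omega>"
    unfolding w(5) by (rule rep_ae_class) simp
  \<comment> \<open>The summand 1 keeps the factor positive when \<open>a\<close> and
    \<open>b\<close> both vanish.\<close>
  then have "AE \<omega> in P. \<bar>rep w \<omega>\<bar> \<le> (a + b + 1) * h \<omega>"
  proof eventually_elim
    case (elim \<omega>)
    have "0 \<le> a * f \<omega>" "0 \<le> b * g \<omega>" "0 \<le> h \<omega>"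
      using w fd(2) gd(2) densitiesD(2)[OF D_Phi_densities[OF h(1)]] by auto
    then show ?case using elim h(2)[of \<omega>] by (simp add: distrib_right)
  qed
  then show ?thesis using that[of "a + b + 1" h] w h by simp
qed

lemma F_finite_dominated:
  assumes "finite Y" "Y \<subseteq> F"
  shows "\<exists>c f. 0 < c \<and> f \<in> D_Phi \<and> (\<forall>w\<in>Y. AE \<omega> in P. \<bar>rep w \<omega>\<bar> \<le> c * f \<omega>)"
  using assms
proof (induction Y)
  case empty
  obtain f where "f \<in> D_Phi" using D_Phi_nonempty by blast
  then show ?case by (auto intro: exI[of _ "1::real"])
next
  case (insert w Y)
  then obtain c f where c: "0 < c" "f \<in> D_Phi" and Y: "\<And>w. w \<in> Y \<Longrightarrow> AE \<omega> in P. \<bar>rep w \<omega>\<bar> \<le> c * f \<omega>"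
    by auto
  obtain d g where d: "0 < d" "g \<in> D_Phi" and w: "AE \<omega> in P. \<bar>rep w \<omega>\<bar> \<le> d * g \<omega>"
    using F_dominated insert.prems by blast
  obtain h where h: "h \<in> D_Phi" "\<And>\<omega>. c * f \<omega> + d * g \<omega> = (c + d) * h \<omega>"
    by (rule convex_fun_cone[OF convex_D_Phi c(2) d(2) less_imp_le[OF c(1)] less_imp_le[OF d(1)]]) blast
  have nn: "0 \<le> c * f \<omega>" "0 \<le> d * g \<omega>" for \<omega>
    using c d densitiesD(2)[OF D_Phi_densities] by auto
  have le: "c * f \<omega> \<le> (c + d) * h \<omega>" "d * g \<omega> \<le> (c + d) * h \<omega>" for \<omega>
    using h(2)[of \<omega>] nn[of \<omega>] by auto
  have "AE \<omega> in P. \<bar>rep v \<omega>\<bar> \<le> (c + d) * h \<omega>" if "v \<in> insert w Y" for v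
  proof (cases "v = w")
    case True
    show ?thesis unfolding True using w by eventually_elim (rule order_trans[OF _ le(2)])
  next
    case False
    with that have "v \<in> Y" by simp
    from Y[OF this] show ?thesis by eventually_elim (rule order_trans[OF _ le(1)])
  qed
  then show ?case using c(1) d(1) h(1) by (intro exI[of _ "c + d"] exI[of _ h]) auto
qed

lemma pairing_integrable:
  assumes X: "X \<in> E" and w: "w \<in> F"
  shows "integrable P (\<lambda>\<omega>. rep X \<omega> * rep w \<omega>)"
proof -
  obtain c f where c: "0 < c" "f \<in> D_Phi" and le: "AE \<omega> in P. \<bar>rep w \<omega>\<bar> \<le> c * f \<omega>"
    by (rule F_dominated[OF w]) blast
  have [measurable]: "rep X \<in> borel_measurable P" "rep w \<in> borel_measurable P"
    using X F_L0[OF w] by (auto simp: E_iff rep_measurable)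
  have "integrable P (\<lambda>\<omega>. c * (rep X \<omega> * f \<omega>))"
    using X c by (simp add: E_iff)
  then show ?thesis
  proof (rule Bochner_Integration.integrable_bound)
    show "AE \<omega> in P. norm (rep X \<omega> * rep w \<omega>) \<le> norm (c * (rep X \<omega> * f \<omega>))"
      using le
    proof eventually_elim
      case (elim \<omega>)
      then have "\<bar>rep X \<omega>\<bar> * \<bar>rep w \<omega>\<bar> \<le> \<bar>rep X \<omega>\<bar> * (c * f \<omega>)"
        by (intro mult_left_mono) auto
      moreover have "0 \<le> f \<omega>" using densitiesD(2)[OF D_Phi_densities[OF c(2)]] .
      ultimately show ?case using c(1) by (simp add: abs_mult mult.left_commute)
    qed
  qed measurable
qed

lemma pairing_ae_class:
  assumes X: "X \<in> L0 P" and [measurable]: "f \<in> borel_measurable P"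
  shows "pairing P X (ae_class P f) = (LINT \<omega>|P. rep X \<omega> * f \<omega>)"
    and "pairing P (ae_class P f) X = (LINT \<omega>|P. rep X \<omega> * f \<omega>)"
proof -
  have [measurable]: "rep X \<in> borel_measurable P" "rep (ae_class P f) \<in> borel_measurable P"
    using X by (auto intro!: rep_measurable ae_class_in_L0)
  have "AE \<omega> in P. rep (ae_class P f) \<omega> = f \<omega>" by (rule rep_ae_class) simp
  then show "pairing P X (ae_class P f) = (LINT \<omega>|P. rep X \<omega> * f \<omega>)"
    "pairing P (ae_class P f) X = (LINT \<omega>|P. rep X \<omega> * f \<omega>)"
    unfolding pairing_def by (auto intro!: integral_cong_AE elim!: eventually_mono simp: mult.commute)
qed

text \<open>\<open>f\<close> is twice the midpoint of \<open>f\<close> and \<open>g\<close>, minus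
  \<open>g\<close>; the midpoint belongs to \<open>D_Phi\<close> because \<open>g\<close> enters
  with positive weight.\<close>

lemma D_hat_F:
  assumes f: "f \<in> D_hat"
  shows "ae_class P f \<in> F"
proof -
  obtain g where g: "g \<in> D_Phi" using D_Phi_nonempty by blast
  have "(\<lambda>\<omega>. 1/2 * f \<omega> + 1/2 * g \<omega>) \<in> D_Phi"
    by (rule D_hat_mixture[OF f g]) auto
  from F_I[OF _ _ this g, of 2 1] show ?thesis by simp
qed

lemma integrable_E_D_hat:
  assumes X: "X \<in> E" and f: "f \<in> D_hat"
  shows "integrable P (\<lambda>\<omega>. rep X \<omega> * f \<omega>)"
proof -
  have [measurable]: "f \<in> borel_measurable P" "rep X \<in> borel_measurable P"
    using X densitiesD(1)[OF D_hat_densities[OF f]] by (auto simp: E_iff rep_measurable)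
  have "AE \<omega> in P. rep X \<omega> * rep (ae_class P f) \<omega> = rep X \<omega> * f \<omega>"
    using rep_ae_class[of f P] by (auto elim!: eventually_mono)
  then show ?thesis
    by (intro integrable_cong_AE_imp[OF pairing_integrable[OF X D_hat_F[OF f]]]) auto
qed

text \<open>Membership in \<open>F\<close> supplies a dominating multiple of an element of
  \<open>D_Phi\<close>; the sign and the inequalities against \<open>K\<close> make the normalised
  function a density of a pricing measure. The lemma serves both the intersection of
  \<open>F\<close> with the wedge over \<open>M1\<close> and the upper bound for the
  closures.\<close>

lemma F_polar_D_hat:
  assumes w: "w \<in> F" and nonneg: "AE \<omega> in P. 0 \<le> rep w \<omega>"
    and K: "\<And>X. X \<in> K \<Longrightarrow> pairing P w X \<le> 0"
  obtains f where "f \<in> D_hat" "0 \<le> (LINT \<omega>|P. rep w \<omega>)"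
    "w = ae_class P (\<lambda>\<omega>. (LINT \<omega>|P. rep w \<omega>) * f \<omega>)"
proof -
  define m where "m = (LINT \<omega>|P. rep w \<omega>)"
  \<comment> \<open>A version of \<open>w\<close> that is nonnegative at every point, as
    \<open>densities\<close> demands.\<close>
  define g where "g \<omega> = max (rep w \<omega>) 0" for \<omega>
  obtain c h where c: "0 < c" "h \<in> D_Phi" and le: "AE \<omega> in P. \<bar>rep w \<omega>\<bar> \<le> c * h \<omega>"
    by (rule F_dominated[OF w]) blast
  have [measurable]: "rep w \<in> borel_measurable P" using F_L0[OF w] by (rule rep_measurable)
  have [measurable]: "g \<in> borel_measurable P" unfolding g_def[abs_def] by measurable
  note hd = densitiesD[OF D_Phi_densities[OF c(2)]]
  have g0: "0 \<le> g \<omega>" for \<omega> by (simp add: g_def)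
  have gw: "AE \<omega> in P. rep w \<omega> = g \<omega>" using nonneg by eventually_elim (simp add: g_def)
  have gle: "AE \<omega> in P. g \<omega> \<le> c * h \<omega>" using gw le by eventually_elim simp
  have g_int: "integrable P g"
    by (rule Bochner_Integration.integrable_bound[of _ "\<lambda>\<omega>. c * h \<omega>"])
      (use hd c gle g0 in \<open>auto elim!: eventually_mono\<close>)
  have m: "m = (LINT \<omega>|P. g \<omega>)"
    unfolding m_def using gw by (intro integral_cong_AE) auto
  have m0: "0 \<le> m" unfolding m using g0 by simp
  have wg: "w = ae_class P g"
    using ae_class_rep[OF F_L0[OF w]] gw by (metis \<open>g \<in> borel_measurable P\<close> \<open>rep w \<in> borel_measurable P\<close> ae_class_eqI)
  have "\<exists>f\<in>D_hat. w = ae_class P (\<lambda>\<omega>. m * f \<omega>)"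
  proof (cases "m = 0")
    \<comment> \<open>Here \<open>w\<close> is the zero class, which is 0 times any density; the
      dominating \<open>h\<close> is at hand.\<close>
    case True
    then have "AE \<omega> in P. g \<omega> = 0"
      using integral_nonneg_eq_0_iff_AE[OF g_int] g0 m by simp
    then have "w = ae_class P (\<lambda>\<omega>. m * h \<omega>)"
      unfolding wg using True hd by (intro ae_class_eqI) auto
    then show ?thesis using c(2) D_Phi_subset_D_hat by blast
  next
    case False
    with m0 have mpos: "0 < m" by simp
    have "(\<lambda>\<omega>. g \<omega> / (LINT \<omega>|P. g \<omega>)) \<in> densities P K"
    proof (rule densities_scaled)
      fix X assume X: "X \<in> K"
      then have XE: "X \<in> E" and [measurable]: "rep X \<in> borel_measurable P"
        using K_subset_E K_L0 by (auto intro: rep_measurable)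
      have eq: "AE \<omega> in P. rep X \<omega> * rep w \<omega> = rep X \<omega> * g \<omega>"
        using gw by eventually_elim simp
      show "integrable P (\<lambda>\<omega>. rep X \<omega> * g \<omega>)"
        by (rule integrable_cong_AE_imp[OF pairing_integrable[OF XE w] _ eq]) measurable
      show "(LINT \<omega>|P. rep X \<omega> * g \<omega>) \<le> 0"
        using K[OF X] pairing_ae_class(2)[of X g] X K_L0 unfolding wg by auto
    qed (use g0 g_int mpos m in auto)
    then have f: "(\<lambda>\<omega>. g \<omega> / m) \<in> densities P K" by (simp add: m)
    have "(\<lambda>\<omega>. g \<omega> / m) \<in> D_hat"
    proof (rule D_hat_dominated[OF f c(2)])
      show "0 < c / m" using c mpos by simp
      show "AE \<omega> in P. g \<omega> / m \<le> c / m * h \<omega>"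
        using gle by eventually_elim (use mpos in \<open>simp add: divide_right_mono\<close>)
    qed
    then show ?thesis using False wg by (intro bexI[of _ "\<lambda>\<omega>. g \<omega> / m"]) simp_all
  qed
  then show ?thesis using that m0 unfolding m_def by blast
qed

section \<open>Weak closures in F\<close>

lemma F_nonempty: "F \<noteq> {}"
  using D_Phi_nonempty D_Phi_subset_D_hat D_hat_F by blast

lemma E_nonempty: "E \<noteq> {}"
  using bounded_E[of "\<lambda>\<omega>. 0"] by auto

lemma D_hat_cone_F:
  assumes f: "f \<in> D_hat" and c: "0 \<le> c"
  shows "ae_class P (\<lambda>\<omega>. c * f \<omega>) \<in> F"
proof -
  obtain g where g: "g \<in> D_Phi" using D_Phi_nonempty by blast
  have "(\<lambda>\<omega>. 1/2 * f \<omega> + 1/2 * g \<omega>) \<in> D_Phi"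
    by (rule D_hat_mixture[OF f g]) auto
  from F_I[OF _ _ this g, of "2 * c" c] c show ?thesis by (simp add: algebra_simps)
qed

text \<open>\<open>A\<close> is an arbitrary part of the cone over \<open>D_Phi\<close>, so that the
  closure of the wedge and that of the densities are treated together.\<close>

lemma closure_polar:
  assumes w: "w \<in> weak_top P F E closure_of A"
    and A: "A \<subseteq> {ae_class P (\<lambda>\<omega>. c * f \<omega>) | c f. 0 \<le> c \<and> f \<in> D_Phi}"
  obtains f where "f \<in> D_hat" "0 \<le> (LINT \<omega>|P. rep w \<omega>)"
    "w = ae_class P (\<lambda>\<omega>. (LINT \<omega>|P. rep w \<omega>) * f \<omega>)"
proof -
  have wF: "w \<in> F"
    using w topspace_weak_top[OF E_nonempty, of P F] unfolding in_closure_of by simp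
  then have [measurable]: "rep w \<in> borel_measurable P" by (intro rep_measurable F_L0)
  \<comment> \<open>The test function is chosen after \<open>w\<close>: the indicator of its
    negative set, which is bounded and so belongs to \<open>E\<close>. Its pairing with
    \<open>w\<close> is nonnegative as a limit, while the integrand \<open>rep w * N\<close> is
    nowhere positive; hence the integrand vanishes almost everywhere.\<close>
  define N where "N = (indicator {\<omega>. rep w \<omega> < 0} :: 'a \<Rightarrow> real)"
  have [measurable]: "N \<in> borel_measurable P"
    unfolding N_def indicator_def[abs_def] of_bool_def by measurable
  have N: "ae_class P N \<in> E" by (rule bounded_E) (auto simp: N_def indicator_def)
  have cone: "pairing P a X = c * (LINT \<omega>|P. rep X \<omega> * f \<omega>)"
    if "a = ae_class P (\<lambda>\<omega>. c * f \<omega>)" "f \<in> D_Phi" "X \<in> E" for a c f X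
    using that densitiesD(1)[OF D_Phi_densities[OF that(2)]] pairing_ae_class(2)[of X "\<lambda>\<omega>. c * f \<omega>"]
    by (simp add: E_iff mult.left_commute)
  have "pairing P w (ae_class P N) \<in> {0..}"
  proof (rule weak_closure_pairing[OF w N])
    fix a assume "a \<in> A"
    then obtain c f where a: "0 \<le> c" "f \<in> D_Phi" "a = ae_class P (\<lambda>\<omega>. c * f \<omega>)" using A by blast
    have "AE \<omega> in P. 0 \<le> rep (ae_class P N) \<omega> * f \<omega>"
      using rep_ae_class[of N P] densitiesD(2)[OF D_Phi_densities[OF a(2)]]
      by (auto elim!: eventually_mono simp: N_def)
    then show "pairing P a (ae_class P N) \<in> {0..}"
      using a(1) cone[OF a(3,2) N] by (simp add: integral_nonneg_AE)
  qed simp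
  then have "0 \<le> (LINT \<omega>|P. rep w \<omega> * N \<omega>)"
    using pairing_ae_class(1)[of w N] F_L0[OF wF] by simp
  moreover have int: "integrable P (\<lambda>\<omega>. rep w \<omega> * N \<omega>)"
  proof (rule integrable_cong_AE_imp[OF pairing_integrable[OF N wF]])
    show "AE \<omega> in P. rep (ae_class P N) \<omega> * rep w \<omega> = rep w \<omega> * N \<omega>"
      using rep_ae_class[of N P] by (auto elim!: eventually_mono)
  qed measurable
  moreover have le: "rep w \<omega> * N \<omega> \<le> 0" for \<omega> by (simp add: N_def indicator_def)
  moreover have "0 \<le> (LINT \<omega>|P. - (rep w \<omega> * N \<omega>))"
    using le by (intro integral_nonneg_AE) simp
  ultimately have "(LINT \<omega>|P. - (rep w \<omega> * N \<omega>)) = 0"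
    by simp
  then have "AE \<omega> in P. - (rep w \<omega> * N \<omega>) = 0"
    using int le by (subst (asm) integral_nonneg_eq_0_iff_AE) auto
  then have "AE \<omega> in P. 0 \<le> rep w \<omega>"
    by eventually_elim (auto simp: N_def indicator_def split: if_splits)
  moreover have "pairing P w X \<le> 0" if X: "X \<in> K" for X
  proof -
    have XE: "X \<in> E" using X K_subset_E by blast
    have "pairing P w X \<in> {..0}"
    proof (rule weak_closure_pairing[OF w XE])
      fix a assume "a \<in> A"
      then obtain c f where a: "0 \<le> c" "f \<in> D_Phi" "a = ae_class P (\<lambda>\<omega>. c * f \<omega>)" using A by blast
      then show "pairing P a X \<in> {..0}"
        using cone[OF a(3,2) XE] densitiesD(6)[OF D_Phi_densities[OF a(2)] X]
        by (simp add: mult_nonneg_nonpos)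
    qed simp
    then show ?thesis by simp
  qed
  ultimately show ?thesis by (rule F_polar_D_hat[OF wF]) (assumption | rule that)+
qed

text \<open>The factor \<open>c\<close> covers both closures: it is arbitrary for the wedge and 1
  for the set of densities.\<close>

lemma D_hat_closure:
  assumes f: "f \<in> D_hat" and c: "0 \<le> c" and A: "A \<subseteq> F"
    and cA: "\<And>h. h \<in> D_Phi \<Longrightarrow> ae_class P (\<lambda>\<omega>. c * h \<omega>) \<in> A"
  shows "ae_class P (\<lambda>\<omega>. c * f \<omega>) \<in> weak_top P F E closure_of A"
proof (rule weak_closureI[OF E_nonempty D_hat_cone_F[OF f c] A])
  fix Y assume Y: "Y \<subseteq> E"
  obtain g where g: "g \<in> D_Phi" using D_Phi_nonempty by blast
  have g': "g \<in> D_hat" using g D_Phi_subset_D_hat by blast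
  note [measurable] = densitiesD(1)[OF D_hat_densities[OF f]] densitiesD(1)[OF D_hat_densities[OF g']]
  \<comment> \<open>The weights are positive, so that every mixture lies in \<open>D_Phi\<close>,
    and at most 1. The resulting sequence is the same for every finite set of pairings.\<close>
  define v where "v n = inverse (real (Suc n))" for n
  have v: "0 < v n" "v n \<le> 1" for n by (auto simp: v_def field_simps)
  have v0: "v \<longlonglongrightarrow> 0" unfolding v_def by (rule LIMSEQ_inverse_real_of_nat)
  define h where "h n \<omega> = (1 - v n) * f \<omega> + v n * g \<omega>" for n \<omega>
  have h: "h n \<in> D_Phi" for n
    unfolding h_def[abs_def] using v by (intro D_hat_mixture[OF f g]) auto
  have "(\<lambda>n. pairing P (ae_class P (\<lambda>\<omega>. c * h n \<omega>)) X) \<longlonglongrightarrow> pairing P (ae_class P (\<lambda>\<omega>. c * f \<omega>)) X"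
    if X: "X \<in> Y" for X
  proof -
    have XE: "X \<in> E" using X Y by blast
    then have XL: "X \<in> L0 P" by (simp add: E_iff)
    let ?f = "LINT \<omega>|P. rep X \<omega> * f \<omega>" and ?g = "LINT \<omega>|P. rep X \<omega> * g \<omega>"
    have "pairing P (ae_class P (\<lambda>\<omega>. c * h n \<omega>)) X = c * ((1 - v n) * ?f + v n * ?g)" for n
    proof -
      have [measurable]: "h n \<in> borel_measurable P" by (rule densitiesD(1)[OF D_Phi_densities[OF h]])
      have "pairing P (ae_class P (\<lambda>\<omega>. c * h n \<omega>)) X = (LINT \<omega>|P. rep X \<omega> * (c * h n \<omega>))"
        using XL by (intro pairing_ae_class(2)) auto
      also have "\<dots> = (LINT \<omega>|P. (c * (1 - v n)) * (rep X \<omega> * f \<omega>) + (c * v n) * (rep X \<omega> * g \<omega>))"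
        by (simp add: h_def algebra_simps)
      also have "\<dots> = (c * (1 - v n)) * ?f + (c * v n) * ?g"
        using integrable_E_D_hat[OF XE f] integrable_E_D_hat[OF XE g'] by simp
      finally show ?thesis by (simp add: algebra_simps)
    qed
    moreover have "(\<lambda>n. c * ((1 - v n) * ?f + v n * ?g)) \<longlonglongrightarrow> c * ((1 - 0) * ?f + 0 * ?g)"
      by (intro tendsto_intros v0)
    moreover have "pairing P (ae_class P (\<lambda>\<omega>. c * f \<omega>)) X = c * ?f"
      using XL by (subst pairing_ae_class(2)) (auto simp: mult.left_commute)
    ultimately show ?thesis by simp
  qed
  with cA h show "\<exists>a. (\<forall>n. a n \<in> A) \<and>
      (\<forall>X\<in>Y. (\<lambda>n. pairing P (a n) X) \<longlonglongrightarrow> pairing P (ae_class P (\<lambda>\<omega>. c * f \<omega>)) X)"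
    by (intro exI[of _ "\<lambda>n. ae_class P (\<lambda>\<omega>. c * h n \<omega>)"]) simp
qed

lemma D_measurable: "densities P K \<subseteq> borel_measurable P" "D_Phi \<subseteq> borel_measurable P" "D_hat \<subseteq> borel_measurable P"
  using densitiesD(1) D_Phi_densities D_hat_densities by auto

lemma D_hat_nonempty: "D_hat \<noteq> {}"
  using D_Phi_nonempty D_Phi_subset_D_hat by blast

lemmas wedge_D_Phi = wedge_hull_ae_class[OF convex_D_Phi D_Phi_nonempty D_measurable(2)]
lemmas wedge_D_hat = wedge_hull_ae_class[OF convex_D_hat D_hat_nonempty D_measurable(3)]

lemma F_inter_wedge: "F \<inter> wedge_hull P (R P ` M1 P K) = wedge_hull P (R P ` M_hat_Phi P K \<Phi>)"
proof -
  have ne: "densities P K \<noteq> {}" using D_hat_nonempty D_hat_densities by blast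
  note W1 = wedge_hull_ae_class[OF convex_densities ne D_measurable(1)]
  show ?thesis
    unfolding R_M1 R_M_hat_Phi W1 wedge_D_hat
  proof (intro equalityI subsetI)
    fix w assume "w \<in> F \<inter> {ae_class P (\<lambda>\<omega>. c * f \<omega>) |c f. 0 \<le> c \<and> f \<in> densities P K}"
    then obtain c f where w: "w \<in> F" and c: "0 \<le> c" "f \<in> densities P K" "w = ae_class P (\<lambda>\<omega>. c * f \<omega>)" by blast
    note fd = densitiesD[OF c(2)]
    have [measurable]: "f \<in> borel_measurable P" by (rule fd)
    have "AE \<omega> in P. 0 \<le> rep w \<omega>"
      using rep_ae_class[of "\<lambda>\<omega>. c * f \<omega>" P] c(1) fd(2) unfolding c(3) by (auto elim!: eventually_mono)
    moreover have "pairing P w X \<le> 0" if X: "X \<in> K" for X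
    proof -
      have "pairing P w X = (LINT \<omega>|P. rep X \<omega> * (c * f \<omega>))"
        unfolding c(3) using X K_L0 by (intro pairing_ae_class(2)) auto
      also have "\<dots> = c * (LINT \<omega>|P. rep X \<omega> * f \<omega>)" by (simp add: mult.left_commute)
      finally show ?thesis using c(1) fd(6)[OF X] by (simp add: mult_nonneg_nonpos)
    qed
    ultimately obtain h where "h \<in> D_hat" "0 \<le> (LINT \<omega>|P. rep w \<omega>)"
      "w = ae_class P (\<lambda>\<omega>. (LINT \<omega>|P. rep w \<omega>) * h \<omega>)"
      by (rule F_polar_D_hat[OF w])
    then show "w \<in> {ae_class P (\<lambda>\<omega>. c * f \<omega>) |c f. 0 \<le> c \<and> f \<in> D_hat}" by blast
  next
    fix w assume "w \<in> {ae_class P (\<lambda>\<omega>. c * f \<omega>) |c f. 0 \<le> c \<and> f \<in> D_hat}"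
    then show "w \<in> F \<inter> {ae_class P (\<lambda>\<omega>. c * f \<omega>) |c f. 0 \<le> c \<and> f \<in> densities P K}"
      using D_hat_cone_F D_hat_densities by blast
  qed
qed

lemma wedge_closure:
  "wedge_hull P (R P ` M_hat_Phi P K \<Phi>) = weak_top P F E closure_of wedge_hull P (R P ` M_Phi P K \<Phi>)"
  unfolding R_M_Phi R_M_hat_Phi wedge_D_Phi wedge_D_hat
proof (intro equalityI subsetI)
  fix w assume "w \<in> {ae_class P (\<lambda>\<omega>. c * f \<omega>) |c f. 0 \<le> c \<and> f \<in> D_hat}"
  then obtain c f where "0 \<le> c" "f \<in> D_hat" "w = ae_class P (\<lambda>\<omega>. c * f \<omega>)" by blast
  then show "w \<in> weak_top P F E closure_of {ae_class P (\<lambda>\<omega>. c * f \<omega>) |c f. 0 \<le> c \<and> f \<in> D_Phi}"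
    using D_hat_cone_F D_Phi_subset_D_hat by (auto intro!: D_hat_closure)
next
  fix w assume "w \<in> weak_top P F E closure_of {ae_class P (\<lambda>\<omega>. c * f \<omega>) |c f. 0 \<le> c \<and> f \<in> D_Phi}"
  from closure_polar[OF this order_refl] show "w \<in> {ae_class P (\<lambda>\<omega>. c * f \<omega>) |c f. 0 \<le> c \<and> f \<in> D_hat}"
    by blast
qed

lemma R_closure: "R P ` M_hat_Phi P K \<Phi> = weak_top P F E closure_of (R P ` M_Phi P K \<Phi>)"
  unfolding R_M_Phi R_M_hat_Phi
proof (intro equalityI subsetI)
  fix w assume "w \<in> ae_class P ` D_hat"
  then obtain f where f: "f \<in> D_hat" "w = ae_class P (\<lambda>\<omega>. 1 * f \<omega>)" by auto
  show "w \<in> weak_top P F E closure_of ae_class P ` D_Phi"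
    unfolding f(2) by (rule D_hat_closure[OF f(1)]) (use D_hat_F D_Phi_subset_D_hat in auto)
next
  fix w assume w: "w \<in> weak_top P F E closure_of ae_class P ` D_Phi"
  have "ae_class P ` D_Phi \<subseteq> {ae_class P (\<lambda>\<omega>. c * f \<omega>) |c f. 0 \<le> c \<and> f \<in> D_Phi}"
  proof
    fix x assume "x \<in> ae_class P ` D_Phi"
    then obtain f where "f \<in> D_Phi" "x = ae_class P (\<lambda>\<omega>. 1 * f \<omega>)" by auto
    then show "x \<in> {ae_class P (\<lambda>\<omega>. c * f \<omega>) |c f. 0 \<le> c \<and> f \<in> D_Phi}" using zero_le_one by blast
  qed
  from closure_polar[OF w this] obtain f where f: "f \<in> D_hat"
    "w = ae_class P (\<lambda>\<omega>. (LINT \<omega>|P. rep w \<omega>) * f \<omega>)" by blast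
  \<comment> \<open>Total mass is the pairing with the constant 1, an element of \<open>E\<close>.
    It equals 1 on all densities and \<open>{1}\<close> is closed, so the factor supplied by
    \<open>closure_polar\<close> is 1.\<close>
  have one: "ae_class P (\<lambda>\<omega>. 1) \<in> E" by (rule bounded_E) auto
  have "w \<in> L0 P"
    using w topspace_weak_top[OF E_nonempty, of P F] F_L0 unfolding in_closure_of by auto
  then have "(LINT \<omega>|P. rep w \<omega>) = pairing P w (ae_class P (\<lambda>\<omega>. 1))"
    by (subst pairing_ae_class(1)) auto
  also have "\<dots> \<in> {1}"
  proof (rule weak_closure_pairing[OF w one])
    fix a assume "a \<in> ae_class P ` D_Phi"
    then obtain g where g: "g \<in> D_Phi" "a = ae_class P g" by blast
    note gd = densitiesD[OF D_Phi_densities[OF g(1)]]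
    note [measurable] = gd(1)
    have "pairing P (ae_class P g) (ae_class P (\<lambda>\<omega>. 1)) = (LINT \<omega>|P. rep (ae_class P g) \<omega> * 1)"
      by (rule pairing_ae_class(1)) (auto intro: ae_class_in_L0)
    also have "\<dots> = (LINT \<omega>|P. g \<omega>)"
      using rep_ae_class[of g P]
      by (intro integral_cong_AE) (auto intro!: rep_measurable ae_class_in_L0)
    finally show "pairing P a (ae_class P (\<lambda>\<omega>. 1)) \<in> {1}" using gd(4) g(2) by simp
  qed simp
  finally have "w = ae_class P f" using f(2) by simp
  with f(1) show "w \<in> ae_class P ` D_hat" by blast
qed

end

section \<open>The solid hull of K and its closures\<close>

lemma rep_L0_diff:
  assumes "X \<in> L0 P" "Y \<in> L0 P"
  shows "L0_diff P X Y \<in> L0 P" "AE \<omega> in P. rep (L0_diff P X Y) \<omega> = rep X \<omega> - rep Y \<omega>"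
proof -
  have [measurable]: "rep X \<in> borel_measurable P" "rep Y \<in> borel_measurable P"
    using assms by (auto intro: rep_measurable)
  show "L0_diff P X Y \<in> L0 P" "AE \<omega> in P. rep (L0_diff P X Y) \<omega> = rep X \<omega> - rep Y \<omega>"
    unfolding L0_diff_def by (rule ae_class_in_L0 rep_ae_class; measurable)+
qed

lemma nonneg_part_AE: "X \<in> nonneg_part P A \<Longrightarrow> AE \<omega> in P. 0 \<le> rep X \<omega>"
  unfolding nonneg_part_def L0_le_def L0_zero_def
  using rep_ae_class[of "\<lambda>\<omega>. 0" P] by auto

lemma nonneg_partI:
  assumes "X \<in> A" "AE \<omega> in P. 0 \<le> rep X \<omega>"
  shows "X \<in> nonneg_part P A"
proof -
  have "AE \<omega> in P. rep (L0_zero P) \<omega> \<le> rep X \<omega>"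
    using rep_ae_class[of "\<lambda>\<omega>. 0" P] assms(2) unfolding L0_zero_def by auto
  with assms(1) show ?thesis by (simp add: nonneg_part_def L0_le_def)
qed

context dual_setting
begin

lemma dens_M_Phi:
  assumes "Q \<in> M_Phi P K \<Phi>"
  shows "prob_space Q" "sets Q = sets P" "absolutely_continuous P Q"
    "density P (\<lambda>\<omega>. ennreal (dens P Q \<omega>)) = Q"
proof -
  show "prob_space Q" and s: "sets Q = sets P" and ac: "absolutely_continuous P Q"
    using assms by (auto simp: M_Phi_def M1_def)
  then show "density P (\<lambda>\<omega>. ennreal (dens P Q \<omega>)) = Q"
    by (intro density_dens prob_space_imp_sigma_finite)
qed

text \<open>Among all \<open>g - z\<close> with \<open>z \<ge> 0\<close>, the minimum of
  \<open>g\<close> and \<open>X\<close> is pointwise nearest to \<open>X\<close>. Its gap is bounded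
  by \<open>\<bar>g\<bar> + \<bar>X\<bar>\<close> and hence lies in \<open>E\<close>, whereas a
  nonnegative element of \<open>L1 P Q\<close> need not be integrable under the other
  measures.\<close>

lemma truncated_gap:
  assumes g: "g \<in> E" and X: "X \<in> E"
  defines "Z \<equiv> ae_class P (\<lambda>\<omega>. max (rep g \<omega> - rep X \<omega>) 0)"
  shows "Z \<in> nonneg_part P E"
    and "AE \<omega> in P. rep (L0_diff P g Z) \<omega> = min (rep g \<omega>) (rep X \<omega>)"
proof -
  have [measurable]: "rep g \<in> borel_measurable P" "rep X \<in> borel_measurable P"
    using g X by (auto simp: E_iff rep_measurable)
  have Z: "AE \<omega> in P. rep Z \<omega> = max (rep g \<omega> - rep X \<omega>) 0"
    unfolding Z_def by (rule rep_ae_class) measurable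
  have ZE: "Z \<in> E"
    unfolding Z_def by (rule E_dominated[OF g X]) (auto intro!: AE_I2)
  then show "Z \<in> nonneg_part P E"
    by (rule nonneg_partI) (use Z in eventually_elim, simp)
  have "g \<in> L0 P" "Z \<in> L0 P" using g ZE by (simp_all add: E_iff)
  from rep_L0_diff(2)[OF this] Z
  show "AE \<omega> in P. rep (L0_diff P g Z) \<omega> = min (rep g \<omega>) (rep X \<omega>)"
    by eventually_elim (auto simp: max_def min_def)
qed

lemma sol_hull_E: "sol_hull P E K \<subseteq> E"
proof
  fix a assume "a \<in> sol_hull P E K"
  then obtain g z where a: "a = L0_diff P g z" "g \<in> E" "z \<in> E"
    using K_subset_E by (auto simp: sol_hull_def nonneg_part_def)
  have [measurable]: "rep g \<in> borel_measurable P" "rep z \<in> borel_measurable P"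
    using a by (auto simp: E_iff rep_measurable)
  show "a \<in> E" unfolding a(1) L0_diff_def by (rule E_dominated[OF a(2,3)]) auto
qed

lemma C_Phi_subset: "C_Phi P K \<Phi> \<subseteq> c_E_Phi P K \<Phi>"
proof
  fix X assume X: "X \<in> C_Phi P K \<Phi>"
  have XL1: "X \<in> L1 P Q" if "Q \<in> M_Phi P K \<Phi>" for Q
    using X that by (auto simp: C_Phi_def L1_closure_def)
  then have XE: "X \<in> E" by (simp add: E_Phi_def)
  then have XL: "X \<in> L0 P" by (simp add: E_iff)
  then have [measurable]: "rep X \<in> borel_measurable P" by (rule rep_measurable)
  show "X \<in> c_E_Phi P K \<Phi>"
    unfolding c_E_Phi_def
  proof (rule weak_closureI[OF F_nonempty XE sol_hull_E])
    fix Y assume Y: "finite Y" "Y \<subseteq> F"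
    obtain c f where c: "0 < c" "f \<in> D_Phi" and dom: "\<And>y. y \<in> Y \<Longrightarrow> AE \<omega> in P. \<bar>rep y \<omega>\<bar> \<le> c * f \<omega>"
      using F_finite_dominated[OF Y] by blast
    note fd = densitiesD[OF D_Phi_densities[OF c(2)]]
    note [measurable] = fd(1)
    define Q where "Q = density P (\<lambda>\<omega>. ennreal (f \<omega>))"
    have Q: "Q \<in> M_Phi P K \<Phi>" unfolding Q_def by (rule density_M_Phi[OF c(2)])
    obtain Xs where Xs: "\<And>n. Xs n \<in> sol_hull P (L1 P Q) K"
      and lim: "(\<lambda>n. LINT \<omega>|Q. \<bar>rep X \<omega> - rep (Xs n) \<omega>\<bar>) \<longlonglongrightarrow> 0"
      using X Q by (auto simp: C_Phi_def L1_closure_def)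
    have "\<exists>g z. Xs n = L0_diff P g z \<and> g \<in> K \<and> z \<in> nonneg_part P (L1 P Q)" for n
      using Xs[of n] unfolding sol_hull_def by blast
    then obtain g z where gz: "\<And>n. Xs n = L0_diff P (g n) (z n)" "\<And>n. g n \<in> K"
      "\<And>n. z n \<in> nonneg_part P (L1 P Q)"
      by metis
    \<comment> \<open>The gap \<open>z n\<close> is known to be integrable under \<open>Q\<close>
      only; the truncated gap lies in \<open>E\<close> and brings the approximant no further from
      \<open>X\<close>.\<close>
    define a where "a n = L0_diff P (g n) (ae_class P (\<lambda>\<omega>. max (rep (g n) \<omega> - rep X \<omega>) 0))" for n
    have gE: "g n \<in> E" for n using gz(2) K_subset_E by blast
    have aK: "a n \<in> sol_hull P E K" for n
      unfolding a_def sol_hull_def using gz(2) truncated_gap(1)[OF gE XE] by blast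
    have "(\<lambda>n. pairing P (a n) y) \<longlonglongrightarrow> pairing P X y" if y: "y \<in> Y" for y
    proof -
      have yF: "y \<in> F" using y Y by blast
      have [measurable]: "rep y \<in> borel_measurable P" by (intro rep_measurable F_L0 yF)
      have "\<bar>pairing P (a n) y - pairing P X y\<bar> \<le> c * (LINT \<omega>|Q. \<bar>rep X \<omega> - rep (Xs n) \<omega>\<bar>)" for n
      proof -
        have aE: "a n \<in> E" using aK sol_hull_E by blast
        have zL: "z n \<in> L0 P" and z_int: "integrable Q (rep (z n))"
          using gz(3) by (auto simp: nonneg_part_def L1_def)
        have gL: "g n \<in> L0 P" using gE by (simp add: E_iff)
        have [measurable]: "rep (a n) \<in> borel_measurable P" "rep (g n) \<in> borel_measurable P"
          "rep (z n) \<in> borel_measurable P" "rep (Xs n) \<in> borel_measurable P"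
          using aE gL zL rep_L0_diff(1)[OF gL zL] by (auto simp: E_iff gz(1) intro: rep_measurable)
        have XsAE: "AE \<omega> in P. rep (Xs n) \<omega> = rep (g n) \<omega> - rep (z n) \<omega>"
          unfolding gz(1) by (rule rep_L0_diff(2)[OF gL zL])
        have int_diff: "integrable P (\<lambda>\<omega>. rep (a n) \<omega> * rep y \<omega> - rep X \<omega> * rep y \<omega>)"
          by (intro Bochner_Integration.integrable_diff pairing_integrable aE XE yF)
        have int_D: "integrable P (\<lambda>\<omega>. \<bar>rep X \<omega> - rep (Xs n) \<omega>\<bar> * f \<omega>)"
        proof (rule integrable_cong_AE_imp)
          have "integrable P (\<lambda>\<omega>. rep (z n) \<omega> * f \<omega>)"
            using z_int integrable_rep_density[OF rep_measurable[OF zL] fd(1,2)] by (simp add: Q_def)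
          then show "integrable P (\<lambda>\<omega>. \<bar>rep X \<omega> * f \<omega> - (rep (g n) \<omega> * f \<omega> - rep (z n) \<omega> * f \<omega>)\<bar>)"
            using XE gE[of n] c(2) by (auto simp: E_iff)
          show "AE \<omega> in P. \<bar>rep X \<omega> * f \<omega> - (rep (g n) \<omega> * f \<omega> - rep (z n) \<omega> * f \<omega>)\<bar> =
              \<bar>rep X \<omega> - rep (Xs n) \<omega>\<bar> * f \<omega>"
            using XsAE
          proof eventually_elim
            case (elim \<omega>)
            have "\<bar>(rep X \<omega> - rep (Xs n) \<omega>) * f \<omega>\<bar> = \<bar>rep X \<omega> - rep (Xs n) \<omega>\<bar> * f \<omega>"
              using fd(2)[of \<omega>] by (simp add: abs_mult)
            then show ?case by (simp add: elim algebra_simps)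
          qed
        qed measurable
        have "\<bar>pairing P (a n) y - pairing P X y\<bar> = \<bar>LINT \<omega>|P. rep (a n) \<omega> * rep y \<omega> - rep X \<omega> * rep y \<omega>\<bar>"
          unfolding pairing_def
          by (subst Bochner_Integration.integral_diff) (intro pairing_integrable aE XE yF refl)+
        also have "\<dots> \<le> (LINT \<omega>|P. \<bar>rep (a n) \<omega> * rep y \<omega> - rep X \<omega> * rep y \<omega>\<bar>)"
          by (rule integral_abs_bound)
        also have "\<dots> \<le> (LINT \<omega>|P. c * (\<bar>rep X \<omega> - rep (Xs n) \<omega>\<bar> * f \<omega>))"
        proof (rule integral_mono_AE)
          show "AE \<omega> in P. \<bar>rep (a n) \<omega> * rep y \<omega> - rep X \<omega> * rep y \<omega>\<bar> \<le> c * (\<bar>rep X \<omega> - rep (Xs n) \<omega>\<bar> * f \<omega>)"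
            using truncated_gap(2)[OF gE[of n] XE] XsAE nonneg_part_AE[OF gz(3)[of n]] dom[OF y]
            unfolding a_def[symmetric]
          proof eventually_elim
            case (elim \<omega>)
            \<comment> \<open>Where \<open>g n\<close> lies below \<open>X\<close>, subtracting the
              nonnegative \<open>z n\<close> only increases the distance from \<open>X\<close>;
              elsewhere the left side is 0.\<close>
            have "\<bar>rep (a n) \<omega> - rep X \<omega>\<bar> \<le> \<bar>rep X \<omega> - rep (Xs n) \<omega>\<bar>"
              using elim(1-3) by (auto simp: min_def)
            then have "\<bar>rep (a n) \<omega> - rep X \<omega>\<bar> * \<bar>rep y \<omega>\<bar> \<le> \<bar>rep X \<omega> - rep (Xs n) \<omega>\<bar> * (c * f \<omega>)"
              using elim(4) by (intro mult_mono) auto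
            then show ?case by (simp add: abs_mult[symmetric] left_diff_distrib[symmetric] mult.left_commute)
          qed
        qed (use int_diff int_D in auto)
        also have "\<dots> = c * (LINT \<omega>|Q. \<bar>rep X \<omega> - rep (Xs n) \<omega>\<bar>)"
          unfolding Q_def using fd(2) by (simp add: integral_density mult.commute)
        finally show ?thesis .
      qed
      then have "\<forall>\<^sub>F n in sequentially. norm (pairing P (a n) y - pairing P X y) \<le>
          c * (LINT \<omega>|Q. \<bar>rep X \<omega> - rep (Xs n) \<omega>\<bar>)"
        by simp
      then show ?thesis
        by (rule LIM_zero_cancel[OF Lim_null_comparison[OF _ tendsto_mult_right_zero[OF lim]]])
    qed
    with aK show "\<exists>a. (\<forall>n. a n \<in> sol_hull P E K) \<and> (\<forall>y\<in>Y. (\<lambda>n. pairing P (a n) y) \<longlonglongrightarrow> pairing P X y)"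
      by (intro exI[of _ a]) simp
  qed
qed

text \<open>If \<open>X\<close> had positive distance from \<open>K - L1_+(Q)\<close> in \<open>L1(Q)\<close>, a separating functional would be
  given by a bounded density \<open>Z\<close> with respect to \<open>Q\<close>. The normalised measure \<open>Z dQ\<close> lies in the
  span of the pricing measures because it is dominated by \<open>Q\<close>, and it separates \<open>X\<close> weakly.\<close>

lemma weak_closure_distance:
  assumes X: "X \<in> c_E_Phi P K \<Phi>" and Q: "Q \<in> M_Phi P K \<Phi>" and e: "0 < e"
  shows "\<exists>g\<in>K. (LINT \<omega>|Q. max (rep X \<omega> - rep g \<omega>) 0) < e"
proof (rule ccontr)
  assume "\<not> ?thesis"
  then have far: "e \<le> (LINT \<omega>|Q. max (rep X \<omega> - rep g \<omega>) 0)" if "g \<in> K" for g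
    using that by force
  interpret Q: prob_space Q by (rule dens_M_Phi(1)[OF Q])
  have sQ[measurable_cong]: "sets Q = sets P" by (rule dens_M_Phi(2)[OF Q])
  have AE_Q: "AE \<omega> in Q. p \<omega>" if "AE \<omega> in P. p \<omega>" for p
    using absolutely_continuous_AE[OF sQ dens_M_Phi(3)[OF Q] that] .
  define f where "f = dens P Q"
  have f: "f \<in> D_Phi" unfolding f_def by (rule dens_D_Phi[OF Q])
  note fd = densitiesD[OF D_Phi_densities[OF f]]
  note [measurable] = fd(1)
  have Q_eq: "Q = density P (\<lambda>\<omega>. ennreal (f \<omega>))" unfolding f_def by (rule dens_M_Phi(4)[OF Q, symmetric])
  have XE: "X \<in> E"
    using X topspace_weak_top[OF F_nonempty, of P E] unfolding c_E_Phi_def in_closure_of by simp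
  have E_Q: "integrable Q (rep Y)" if "Y \<in> E" for Y
    using that Q by (auto simp: E_Phi_def L1_def)
  \<comment> \<open>Sums and multiples in \<open>K\<close> are formed on classes, so their
    representatives agree with the pointwise operations only almost everywhere. Admitting all
    integrable versions makes \<open>G\<close> a cone of functions.\<close>
  define G where "G = {h. integrable Q h \<and> (\<exists>g\<in>K. AE \<omega> in P. h \<omega> = rep g \<omega>)}"
  have G_rep: "rep g \<in> G" if "g \<in> K" for g
    using that E_Q K_subset_E by (auto simp: G_def)
  have K_meas: "rep g \<in> borel_measurable P" if "g \<in> K" for g
    using that K_L0 by (intro rep_measurable) auto
  obtain Z where Z: "Z \<in> borel_measurable Q" "\<And>\<omega>. 0 \<le> Z \<omega>" "\<And>\<omega>. Z \<omega> \<le> 1"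
    and Z_G: "\<And>g. g \<in> G \<Longrightarrow> (LINT \<omega>|Q. Z \<omega> * g \<omega>) \<le> 0"
    and Z_X: "0 < (LINT \<omega>|Q. Z \<omega> * rep X \<omega>)"
  proof (rule Q.convex_cone_separation[of G "rep X" e])
    show "integrable Q h" if "h \<in> G" for h using that by (simp add: G_def)
    show "(\<lambda>\<omega>. 0) \<in> G"
    proof -
      have "AE \<omega> in P. 0 = rep (ae_class P (\<lambda>\<omega>. 0)) \<omega>"
        using rep_ae_class[of "\<lambda>\<omega>. 0" P] by (auto elim!: eventually_mono)
      then show ?thesis using wedge_zero[OF wedge_K] by (auto simp: G_def)
    qed
    show "(\<lambda>\<omega>. h \<omega> + k \<omega>) \<in> G" if hk: "h \<in> G" "k \<in> G" for h k
    proof -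
      obtain g1 g2 where g: "g1 \<in> K" "g2 \<in> K" and AEs: "AE \<omega> in P. h \<omega> = rep g1 \<omega>" "AE \<omega> in P. k \<omega> = rep g2 \<omega>"
        using hk by (auto simp: G_def)
      note [measurable] = K_meas[OF g(1)] K_meas[OF g(2)]
      have "AE \<omega> in P. h \<omega> + k \<omega> = rep (ae_class P (\<lambda>\<omega>. rep g1 \<omega> + rep g2 \<omega>)) \<omega>"
        using AEs rep_ae_class[of "\<lambda>\<omega>. rep g1 \<omega> + rep g2 \<omega>" P] by auto
      then show ?thesis using hk wedge_add[OF wedge_K g] by (auto simp: G_def)
    qed
    show "(\<lambda>\<omega>. c * h \<omega>) \<in> G" if c: "0 < c" and h: "h \<in> G" for c h
    proof -
      obtain g where g: "g \<in> K" and AEg: "AE \<omega> in P. h \<omega> = rep g \<omega>"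
        using h by (auto simp: G_def)
      note [measurable] = K_meas[OF g]
      have "AE \<omega> in P. c * h \<omega> = rep (ae_class P (\<lambda>\<omega>. c * rep g \<omega>)) \<omega>"
        using AEg rep_ae_class[of "\<lambda>\<omega>. c * rep g \<omega>" P] by auto
      then show ?thesis using h wedge_scale[OF wedge_K g less_imp_le[OF c]] by (auto simp: G_def)
    qed
    show "integrable Q (rep X)" by (rule E_Q[OF XE])
    show "e \<le> (LINT \<omega>|Q. max (rep X \<omega> - h \<omega>) 0)" if h: "h \<in> G" for h
    proof -
      obtain g where g: "g \<in> K" and AEg: "AE \<omega> in P. h \<omega> = rep g \<omega>"
        using h by (auto simp: G_def)
      have "(LINT \<omega>|Q. max (rep X \<omega> - h \<omega>) 0) = (LINT \<omega>|Q. max (rep X \<omega> - rep g \<omega>) 0)"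
        using AE_Q[OF AEg] E_Q[OF XE] E_Q[of g] g K_subset_E h
        by (intro integral_cong_AE) (auto simp: G_def)
      with far[OF g] show ?thesis by simp
    qed
  qed (use e in auto)
  have [measurable]: "Z \<in> borel_measurable P" using Z(1) by measurable
  define w where "w \<omega> = Z \<omega> * f \<omega>" for \<omega>
  have [measurable]: "w \<in> borel_measurable P" unfolding w_def[abs_def] by measurable
  have w0: "0 \<le> w \<omega>" and w_le: "w \<omega> \<le> f \<omega>" for \<omega>
    using Z fd(2)[of \<omega>] by (auto simp: w_def mult_left_le_one_le)
  have w_int: "integrable P w"
    by (rule Bochner_Integration.integrable_bound[OF fd(3)]) (use w0 w_le fd(2) in auto)
  have Ew_int: "integrable P (\<lambda>\<omega>. rep Y \<omega> * w \<omega>)" if Y: "Y \<in> E" for Y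
  proof (rule Bochner_Integration.integrable_bound)
    show "integrable P (\<lambda>\<omega>. rep Y \<omega> * f \<omega>)" using Y f by (simp add: E_iff)
    have [measurable]: "rep Y \<in> borel_measurable P" using Y by (auto simp: E_iff rep_measurable)
    show "(\<lambda>\<omega>. rep Y \<omega> * w \<omega>) \<in> borel_measurable P" by measurable
    show "AE \<omega> in P. norm (rep Y \<omega> * w \<omega>) \<le> norm (rep Y \<omega> * f \<omega>)"
      using w0 w_le fd(2) by (auto simp: abs_mult intro!: mult_left_mono)
  qed
  have Zw: "(LINT \<omega>|Q. Z \<omega> * rep Y \<omega>) = (LINT \<omega>|P. rep Y \<omega> * w \<omega>)" if Y: "Y \<in> E" for Y
  proof -
    have [measurable]: "rep Y \<in> borel_measurable P" using Y by (auto simp: E_iff rep_measurable)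
    have "(LINT \<omega>|Q. Z \<omega> * rep Y \<omega>) = (LINT \<omega>|P. f \<omega> *\<^sub>R (Z \<omega> * rep Y \<omega>))"
      unfolding Q_eq using fd(2) by (intro integral_density) auto
    then show ?thesis by (simp add: w_def ac_simps)
  qed
  define m where "m = (LINT \<omega>|P. w \<omega>)"
  \<comment> \<open>If \<open>Z\<close> had no mass under \<open>Q\<close>, then \<open>w\<close>
    would vanish almost everywhere and the integral against \<open>X\<close> would be 0, contrary to
    \<open>Z_X\<close>.\<close>
  have m: "0 < m"
  proof (rule ccontr)
    assume "\<not> 0 < m"
    moreover have "0 \<le> m" unfolding m_def using w0 by simp
    ultimately have "m = 0" by simp
    then have "AE \<omega> in P. w \<omega> = 0"
      using integral_nonneg_eq_0_iff_AE[OF w_int] w0 by (simp add: m_def)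
    then have "(LINT \<omega>|P. rep X \<omega> * w \<omega>) = (LINT \<omega>|P. 0)"
      using borel_measurable_integrable[OF Ew_int[OF XE]]
      by (intro integral_cong_AE) (auto elim!: eventually_mono)
    with Z_X Zw[OF XE] show False by simp
  qed
  have w_dens: "(\<lambda>\<omega>. w \<omega> / m) \<in> densities P K"
    unfolding m_def
  proof (rule densities_scaled)
    fix g assume g: "g \<in> K"
    then have "g \<in> E" using K_subset_E by blast
    then show "integrable P (\<lambda>\<omega>. rep g \<omega> * w \<omega>)" "(LINT \<omega>|P. rep g \<omega> * w \<omega>) \<le> 0"
      using Ew_int Zw[of g] Z_G[OF G_rep[OF g]] by auto
  qed (use w0 w_int m m_def in auto)
  have w_hat: "(\<lambda>\<omega>. w \<omega> / m) \<in> D_hat"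
    by (rule D_hat_dominated[OF w_dens f, of "1 / m"])
      (use m w_le in \<open>auto intro: divide_right_mono less_imp_le\<close>)
  have pair: "pairing P Y (ae_class P (\<lambda>\<omega>. w \<omega> / m)) = (LINT \<omega>|P. rep Y \<omega> * w \<omega>) / m" if "Y \<in> L0 P" for Y
    using that by (subst pairing_ae_class(1)) auto
  have "pairing P X (ae_class P (\<lambda>\<omega>. w \<omega> / m)) \<in> {..0}"
  proof (rule weak_closure_pairing[OF X[unfolded c_E_Phi_def] D_hat_F[OF w_hat]])
    fix a assume a: "a \<in> sol_hull P E K"
    then obtain g z where gz: "a = L0_diff P g z" "g \<in> K" "z \<in> nonneg_part P E"
      by (auto simp: sol_hull_def)
    have gE: "g \<in> E" and zE: "z \<in> E" using gz K_subset_E by (auto simp: nonneg_part_def)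
    have aE: "a \<in> E" using a sol_hull_E by blast
    have L: "g \<in> L0 P" "z \<in> L0 P" "a \<in> L0 P" using gE zE aE by (simp_all add: E_iff)
    note [measurable] = rep_measurable[OF L(1)] rep_measurable[OF L(2)] rep_measurable[OF L(3)]
    \<comment> \<open>Since \<open>w\<close> is nonnegative, subtracting \<open>z\<close> lowers the
      integral; this carries the sign from \<open>K\<close> to the solid hull.\<close>
    have "(LINT \<omega>|P. rep a \<omega> * w \<omega>) \<le> (LINT \<omega>|P. rep g \<omega> * w \<omega>)"
    proof (rule integral_mono_AE[OF Ew_int[OF aE] Ew_int[OF gE]])
      show "AE \<omega> in P. rep a \<omega> * w \<omega> \<le> rep g \<omega> * w \<omega>"
        using rep_L0_diff(2)[OF L(1,2)] nonneg_part_AE[OF gz(3)] unfolding gz(1)[symmetric]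
        by eventually_elim (auto intro: mult_right_mono w0)
    qed
    also have "\<dots> \<le> 0" using Zw[OF gE] Z_G[OF G_rep[OF gz(2)]] by simp
    finally show "pairing P a (ae_class P (\<lambda>\<omega>. w \<omega> / m)) \<in> {..0}"
      using m pair[OF L(3)] by (simp add: divide_nonpos_pos)
  qed simp
  moreover have "0 < pairing P X (ae_class P (\<lambda>\<omega>. w \<omega> / m))"
    using pair[of X] XE Z_X Zw[OF XE] m by (simp add: E_iff)
  ultimately show False by simp
qed

text \<open>The one-sided distance of \<open>X\<close> from \<open>K\<close> in \<open>L1(Q)\<close>
  is 0 by the preceding lemma. Elements \<open>g n\<close> of \<open>K\<close> within
  \<open>inverse (real (Suc n))\<close> become genuine approximants after truncation at
  \<open>X\<close>.\<close>

lemma c_E_Phi_subset: "c_E_Phi P K \<Phi> \<subseteq> C_Phi P K \<Phi>"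
proof
  fix X assume X: "X \<in> c_E_Phi P K \<Phi>"
  have XE: "X \<in> E"
    using X topspace_weak_top[OF F_nonempty, of P E] unfolding c_E_Phi_def in_closure_of by simp
  have "X \<in> L1_closure P Q (sol_hull P (L1 P Q) K)" if Q: "Q \<in> M_Phi P K \<Phi>" for Q
  proof -
    have E_L1: "E \<subseteq> L1 P Q" using Q by (auto simp: E_Phi_def)
    have sQ[measurable_cong]: "sets Q = sets P" by (rule dens_M_Phi(2)[OF Q])
    define v where "v n = inverse (real (Suc n))" for n
    have "\<exists>g\<in>K. (LINT \<omega>|Q. max (rep X \<omega> - rep g \<omega>) 0) < v n" for n
      by (rule weak_closure_distance[OF X Q]) (simp add: v_def)
    then obtain g where g: "\<And>n. g n \<in> K" "\<And>n. (LINT \<omega>|Q. max (rep X \<omega> - rep (g n) \<omega>) 0) < v n"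
      by metis
    have gE: "g n \<in> E" for n using g(1) K_subset_E by blast
    define Xs where "Xs n = L0_diff P (g n) (ae_class P (\<lambda>\<omega>. max (rep (g n) \<omega> - rep X \<omega>) 0))" for n
    have XsE: "Xs n \<in> sol_hull P E K" for n
      unfolding Xs_def sol_hull_def using g(1) truncated_gap(1)[OF gE XE] by blast
    then have "Xs n \<in> sol_hull P (L1 P Q) K" for n
      using E_L1 unfolding sol_hull_def nonneg_part_def by blast
    moreover have "(\<lambda>n. LINT \<omega>|Q. \<bar>rep X \<omega> - rep (Xs n) \<omega>\<bar>) \<longlonglongrightarrow> 0"
    proof (rule Lim_null_comparison)
      \<comment> \<open>The truncation turns the one-sided error into the full L1 error: the
        distance from \<open>X\<close> to the minimum of \<open>g n\<close> and \<open>X\<close> is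
        the positive part of \<open>X - g n\<close>.\<close>
      have eq: "(LINT \<omega>|Q. \<bar>rep X \<omega> - rep (Xs n) \<omega>\<bar>) = (LINT \<omega>|Q. max (rep X \<omega> - rep (g n) \<omega>) 0)" for n
      proof (rule integral_cong_AE)
        have [measurable]: "rep X \<in> borel_measurable P" "rep (g n) \<in> borel_measurable P"
          "rep (Xs n) \<in> borel_measurable P"
          using XE gE[of n] XsE[of n] sol_hull_E by (auto simp: E_iff rep_measurable)
        show "(\<lambda>\<omega>. \<bar>rep X \<omega> - rep (Xs n) \<omega>\<bar>) \<in> borel_measurable Q"
          "(\<lambda>\<omega>. max (rep X \<omega> - rep (g n) \<omega>) 0) \<in> borel_measurable Q" by measurable
        have "AE \<omega> in P. \<bar>rep X \<omega> - rep (Xs n) \<omega>\<bar> = max (rep X \<omega> - rep (g n) \<omega>) 0"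
          using truncated_gap(2)[OF gE[of n] XE] unfolding Xs_def[symmetric]
          by eventually_elim (auto simp: min_def max_def)
        then show "AE \<omega> in Q. \<bar>rep X \<omega> - rep (Xs n) \<omega>\<bar> = max (rep X \<omega> - rep (g n) \<omega>) 0"
          by (rule absolutely_continuous_AE[OF sQ dens_M_Phi(3)[OF Q]])
      qed
      show "\<forall>\<^sub>F n in sequentially. norm (LINT \<omega>|Q. \<bar>rep X \<omega> - rep (Xs n) \<omega>\<bar>) \<le> v n"
        using g(2) by (intro always_eventually) (simp add: eq less_imp_le)
      show "v \<longlonglongrightarrow> 0" unfolding v_def by (rule LIMSEQ_inverse_real_of_nat)
    qed
    ultimately show ?thesis
      using XE E_L1 unfolding L1_closure_def by blast
  qed
  then show "X \<in> C_Phi P K \<Phi>" unfolding C_Phi_def by blast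
qed

end

theorem theorem6p4:
  fixes P :: "'a measure" and K :: "'a rv_class set" and \<Phi> :: "real \<Rightarrow> ereal"
  assumes "prob_space P"
    and "wedge P K"
    and "\<forall>y\<ge>0. \<Phi> y \<noteq> -\<infinity>"
    and "\<forall>y>0. \<Phi> y \<noteq> \<infinity>"
    and "convex_on_halfline \<Phi>"
    and "growth_condition \<Phi>"
    and "M_Phi P K \<Phi> \<noteq> {}"
  shows "F_Phi P K \<Phi> \<inter> wedge_hull P (R P ` M1 P K) = wedge_hull P (R P ` M_hat_Phi P K \<Phi>)
       \<and> wedge_hull P (R P ` M_hat_Phi P K \<Phi>)
         = weak_top P (F_Phi P K \<Phi>) (E_Phi P K \<Phi>) closure_of wedge_hull P (R P ` M_Phi P K \<Phi>)
       \<and> C_Phi P K \<Phi> = c_E_Phi P K \<Phi>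
       \<and> c_E_Phi P K \<Phi> = weak_top P (E_Phi P K \<Phi>) (F_Phi P K \<Phi>) closure_of K_Phi P K \<Phi>
       \<and> R P ` M_hat_Phi P K \<Phi>
         = weak_top P (F_Phi P K \<Phi>) (E_Phi P K \<Phi>) closure_of (R P ` M_Phi P K \<Phi>)"
proof -
  interpret prob_space P by fact
  interpret dual_setting P K \<Phi>
    by unfold_locales (use assms in auto)
  have "C_Phi P K \<Phi> = c_E_Phi P K \<Phi>"
    by (rule equalityI[OF C_Phi_subset c_E_Phi_subset])
  \<comment> \<open>Both sides are the closure of the same solid hull, so unfolding
    suffices.\<close>
  moreover have "c_E_Phi P K \<Phi> = weak_top P E F closure_of K_Phi P K \<Phi>"
    by (simp add: c_E_Phi_def K_Phi_def)
  ultimately show ?thesis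
    using F_inter_wedge wedge_closure R_closure by simp
qed

end
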